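(* Let $(\mathcal F,\partial,\int)$ be an ordinary shifted integro-differential algebra over an ordered field $K$. The distribution module $(\mathcal D\mathcal F,D,I)$ is the universal Dirac module over $(\mathcal F,\partial,\int)$ that extends $(\mathcal P\mathcal F,\int)$ as a Rota-Baxter module. In other words, $\mathcal D\mathcal F$, with the canonical embedding $\iota\colon\mathcal P\mathcal F\hookrightarrow\mathcal D\mathcal F$, is a Dirac module, and for every Dirac module $(\mathcal M,D_{\mathcal M},I_{\mathcal M})$ with embedding $\kappa\colon\mathcal P\mathcal F\hookrightarrow\mathcal M$ there is a unique integro-differential morphism $\Phi\colon\mathcal D\mathcal F\to\mathcal M$ with $\Phi\circ\iota=\kappa$.
   Context: All algebras are commutative and unital; $[P,Q]=PQ-QP$. **Heaviside operator.** $H\colon K\to K$ is $H(a)=0$ for $a\le 0$ and $H(a)=1$ for $a>0$; $\bar H(a)=1-H(a)$; $a\sqcup b=\max(a,b)$. **Integro-differential algebra.** $(\mathcal F,\partial,\int)$ is a differential $K$-algebra with a $K$-linear map $\int$ such that $\partial\int=1$ and $f\int g=\int fg+\int(f'\int g)$. It is ordinary if $\ker\partial=K$; then $\mathsf e:=1-\int\partial$ is a $K$-algebra homomorphism $\mathcal F\to K$. It is shifted if there is a group homomorphism $S\colon(K,+)\to\operatorname{Aut}_K(\mathcal F)$, $c\mapsto S_c$, with $[S_c,\int]=\mathsf e_c\int$ and $[S_c,\partial]=0$, where $\mathsf e_c:=\mathsf e\circ S_c$. Set $\int_c:=(1-\mathsf e_c)\int$, $\int_c^d:=\mathsf e_d\int_c$.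 **Piecewise extension.** $\mathcal P\mathcal F$ is the free $\mathcal F$-module on $1$ and $H_a$ $(a\in K)$, an algebra via $H_aH_b=H_{a\sqcup b}$. Its Rota-Baxter operator is the $K$-linear extension of $\int$ on $\mathcal F$ with $\int fH_a=(\int_af)H_a+\bar H(a)\int_0^af$. **Distribution module.** Let $\mathcal F\{H_a\mid a\in K\}_1$ be the free $\mathcal F$-module on $1$ and all $H_a^{(k)}$ $(a\in K,k\ge 0)$, with derivation extending $\partial$, sending $H_a^{(k)}\mapsto H_a^{(k+1)}$ and obeying the Leibniz rule over $\mathcal F$. Put $\delta_a:=H_a'$ and let $Z$ be the differential $\mathcal F$-submodule generated by all $f\delta_a-\mathsf e_a(f)\delta_a$. Then $\mathcal D\mathcal F:=\mathcal F\{H_a\mid a\in K\}_1/Z$, $D$ is the induced derivation, and $I$ is the (well-defined) $K$-linear map that equals $\int$ on $\mathcal P\mathcal F\subset\mathcal D\mathcal F$ (embedding $\iota$: $H_a\mapsto H_a$) and satisfies $I(f\delta_a)=\mathsf e_a(f)(H_a-\bar H(a))$ and $I(f\delta_a^{(k)})=f\delta_a^{(k-1)}-I(f'\delta_a^{(k-1)})$ for $k>0$. **Modules.** A Rota-Baxter module over $(\mathcal F,\int)$ is an $\mathcal F$-module $M$ with a $K$-linear $I$ satisfying $(\int f)\cdot I\phi=I(f\,I\phi)+I((\int f)\phi)$. A differential Rota-Baxter module $(M,D,I)$ has in addition a $K$-linear $D$ with $D(f\phi)=(\partial f)\phi+f\,D\phi$ and $D\circ I=1_M$. It is an integro-differential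 module if $\mathsf E:=1_M-I D$ satisfies $\mathsf E(f\phi)=\mathsf e(f)\mathsf E(\phi)$ for all $f\in\mathcal F,\phi\in M$. Morphisms of such modules are $\mathcal F$-linear maps commuting with the operators involved; an integro-differential morphism commutes with both $D$ and $I$. **Dirac module.** An integro-differential module $(\mathcal M,D_{\mathcal M},I_{\mathcal M})$ over $\mathcal F$ together with an embedding $\kappa\colon\mathcal P\mathcal F\hookrightarrow\mathcal M$ of Rota-Baxter $\mathcal F$-modules is a Dirac module if, writing $H_a$ for $\kappa(H_a)$, $\bar H(a)$ for $\bar H(a)\kappa(1)$, and $\delta_a:=D_{\mathcal M}H_a$, $\delta_a^{(k)}:=D_{\mathcal M}^k\delta_a$, one has $f\delta_a=\mathsf e_a(f)\delta_a$, $I_{\mathcal M}\delta_a=H_a-\bar H(a)$ and $I_{\mathcal M}\delta_a^{(k+1)}=\delta_a^{(k)}$ for all $f\in\mathcal F$, $a\in K$, $k\ge0$. *)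

theory Defs
  imports "HOL-Algebra.Algebraic_Closure_Type" "HOL-Library.Poly_Mapping"
begin

text \<open>
  The ordered field \<open>K\<close> and the commutative algebra \<open>\<F>\<close> are types. Modules over \<open>\<F>\<close> have explicit
  carriers (locale \<open>module\<close> over \<open>ring_of_type_algebra\<close>, the type \<open>\<F>\<close> seen as a ring record),
  because the distribution module is a quotient that depends on the operations of \<open>\<F>\<close> and so
  cannot be a type. The field \<open>K\<close> acts on \<open>\<F>\<close>-modules through the multiples \<open>scaleK c 1\<close> of the
  unit of \<open>\<F>\<close>.
\<close>

section \<open>Integro-differential algebras\<close>

definition heaviside :: "'k::linordered_field \<Rightarrow> 'k" where
  "heaviside a = (if a \<le> 0 then 0 else 1)"

definition coheaviside :: "'k::linordered_field \<Rightarrow> 'k" where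
  "coheaviside a = 1 - heaviside a"

locale integro_differential_algebra = K: vector_space scaleK
  for scaleK :: "'k::linordered_field \<Rightarrow> 'f::comm_ring_1 \<Rightarrow> 'f"
    and der :: "'f \<Rightarrow> 'f" and intg :: "'f \<Rightarrow> 'f" +
  assumes scaleK_mult_left: "scaleK c (f * g) = scaleK c f * g"
    and der_linear: "Vector_Spaces.linear scaleK scaleK der"
    and der_mult: "der (f * g) = der f * g + f * der g"
    and intg_linear: "Vector_Spaces.linear scaleK scaleK intg"
    and der_intg: "der (intg f) = f"
    and intg_by_parts: "f * intg g = intg (f * g) + intg (der f * intg g)"
begin

text \<open>In the ordinary case \<open>eval0\<close> takes values in the constants \<open>K \<cdot> 1\<close>.\<close>

definition eval0 :: "'f \<Rightarrow> 'f" where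
  "eval0 f = f - intg (der f)"

end

locale ordinary_integro_differential_algebra = integro_differential_algebra +
  assumes ordinary: "{f. der f = 0} = range (\<lambda>c. scaleK c 1)"

locale ordinary_shifted_integro_differential_algebra =
  ordinary_integro_differential_algebra scaleK der intg
  for scaleK :: "'k::linordered_field \<Rightarrow> 'f::comm_ring_1 \<Rightarrow> 'f"
    and der :: "'f \<Rightarrow> 'f" and intg :: "'f \<Rightarrow> 'f" and S :: "'k \<Rightarrow> 'f \<Rightarrow> 'f" +
  assumes shift_bij: "bij (S c)"
    and shift_linear: "Vector_Spaces.linear scaleK scaleK (S c)"
    and shift_mult: "S c (f * g) = S c f * S c g"
    and shift_one: "S c 1 = 1"
    and shift_hom: "S (c + d) = S c \<circ> S d"
    and shift_intg: "S c (intg f) - intg (S c f) = eval0 (S c (intg f))"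
    and shift_der: "S c (der f) - der (S c f) = 0"
begin

definition eval_at :: "'k \<Rightarrow> 'f \<Rightarrow> 'f" where
  "eval_at c f = eval0 (S c f)"

definition intg_from :: "'k \<Rightarrow> 'f \<Rightarrow> 'f" where
  "intg_from c f = intg f - eval_at c (intg f)"

definition intg_between :: "'k \<Rightarrow> 'k \<Rightarrow> 'f \<Rightarrow> 'f" where
  "intg_between c d f = eval_at d (intg_from c f)"

end

section \<open>Modules with operators\<close>

locale rota_baxter_module = module ring_of_type_algebra M
  for scaleK :: "'k::linordered_field \<Rightarrow> 'f::comm_ring_1 \<Rightarrow> 'f" and intg :: "'f \<Rightarrow> 'f"
    and M :: "('f, 'm, 'x) module_scheme" (structure) and I :: "'m \<Rightarrow> 'm" +
  assumes I_closed: "\<phi> \<in> carrier M \<Longrightarrow> I \<phi> \<in> carrier M"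
    and I_add: "\<phi> \<in> carrier M \<Longrightarrow> \<psi> \<in> carrier M \<Longrightarrow> I (\<phi> \<oplus>\<^bsub>M\<^esub> \<psi>) = I \<phi> \<oplus>\<^bsub>M\<^esub> I \<psi>"
    and I_scale: "\<phi> \<in> carrier M \<Longrightarrow> I (scaleK c 1 \<odot>\<^bsub>M\<^esub> \<phi>) = scaleK c 1 \<odot>\<^bsub>M\<^esub> I \<phi>"
    and rota_baxter: "\<phi> \<in> carrier M \<Longrightarrow>
      intg f \<odot>\<^bsub>M\<^esub> I \<phi> = I (f \<odot>\<^bsub>M\<^esub> I \<phi>) \<oplus>\<^bsub>M\<^esub> I (intg f \<odot>\<^bsub>M\<^esub> \<phi>)"

locale differential_rota_baxter_module = rota_baxter_module scaleK intg M I
  for scaleK :: "'k::linordered_field \<Rightarrow> 'f::comm_ring_1 \<Rightarrow> 'f"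
    and der :: "'f \<Rightarrow> 'f" and intg :: "'f \<Rightarrow> 'f"
    and M :: "('f, 'm, 'x) module_scheme" (structure) and D :: "'m \<Rightarrow> 'm" and I :: "'m \<Rightarrow> 'm" +
  assumes D_closed: "\<phi> \<in> carrier M \<Longrightarrow> D \<phi> \<in> carrier M"
    and D_add: "\<phi> \<in> carrier M \<Longrightarrow> \<psi> \<in> carrier M \<Longrightarrow> D (\<phi> \<oplus>\<^bsub>M\<^esub> \<psi>) = D \<phi> \<oplus>\<^bsub>M\<^esub> D \<psi>"
    and D_scale: "\<phi> \<in> carrier M \<Longrightarrow> D (scaleK c 1 \<odot>\<^bsub>M\<^esub> \<phi>) = scaleK c 1 \<odot>\<^bsub>M\<^esub> D \<phi>"
    and D_smult: "\<phi> \<in> carrier M \<Longrightarrow> D (f \<odot>\<^bsub>M\<^esub> \<phi>) = der f \<odot>\<^bsub>M\<^esub> \<phi> \<oplus>\<^bsub>M\<^esub> f \<odot>\<^bsub>M\<^esub> D \<phi>"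
    and D_I: "\<phi> \<in> carrier M \<Longrightarrow> D (I \<phi>) = \<phi>"
begin

definition E :: "'m \<Rightarrow> 'm" where
  "E \<phi> = \<phi> \<ominus>\<^bsub>M\<^esub> I (D \<phi>)"

end

locale integro_differential_module =
  A: integro_differential_algebra scaleK der intg +
  differential_rota_baxter_module scaleK der intg M D I
  for scaleK :: "'k::linordered_field \<Rightarrow> 'f::comm_ring_1 \<Rightarrow> 'f"
    and der :: "'f \<Rightarrow> 'f" and intg :: "'f \<Rightarrow> 'f"
    and M :: "('f, 'm, 'x) module_scheme" (structure) and D :: "'m \<Rightarrow> 'm" and I :: "'m \<Rightarrow> 'm" +
  assumes E_smult: "\<phi> \<in> carrier M \<Longrightarrow> E (f \<odot>\<^bsub>M\<^esub> \<phi>) = A.eval0 f \<odot>\<^bsub>M\<^esub> E \<phi>"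

definition linear_on_modules ::
  "('f, 'm, 'x) module_scheme \<Rightarrow> ('f, 'n, 'y) module_scheme \<Rightarrow> ('m \<Rightarrow> 'n) \<Rightarrow> bool" where
  "linear_on_modules M N h \<longleftrightarrow>
     h \<in> carrier M \<rightarrow> carrier N \<and>
     (\<forall>\<phi>\<in>carrier M. \<forall>\<psi>\<in>carrier M. h (\<phi> \<oplus>\<^bsub>M\<^esub> \<psi>) = h \<phi> \<oplus>\<^bsub>N\<^esub> h \<psi>) \<and>
     (\<forall>f. \<forall>\<phi>\<in>carrier M. h (f \<odot>\<^bsub>M\<^esub> \<phi>) = f \<odot>\<^bsub>N\<^esub> h \<phi>)"

definition commutes_on ::
  "('m, 'x) partial_object_scheme \<Rightarrow> ('m \<Rightarrow> 'm) \<Rightarrow> ('n \<Rightarrow> 'n) \<Rightarrow> ('m \<Rightarrow> 'n) \<Rightarrow> bool" where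
  "commutes_on M P Q h \<longleftrightarrow> (\<forall>\<phi>\<in>carrier M. h (P \<phi>) = Q (h \<phi>))"

locale rota_baxter_hom =
  dom: rota_baxter_module scaleK intg M I + cod: rota_baxter_module scaleK intg N J
  for scaleK :: "'k::linordered_field \<Rightarrow> 'f::comm_ring_1 \<Rightarrow> 'f" and intg :: "'f \<Rightarrow> 'f"
    and M :: "('f, 'm, 'x) module_scheme" and I :: "'m \<Rightarrow> 'm"
    and N :: "('f, 'n, 'y) module_scheme" and J :: "'n \<Rightarrow> 'n" and h :: "'m \<Rightarrow> 'n" +
  assumes linear: "linear_on_modules M N h"
    and commutes: "commutes_on M I J h"

locale integro_differential_hom =
  dom: integro_differential_module scaleK der intg M D I +
  cod: integro_differential_module scaleK der intg N D' J
  for scaleK :: "'k::linordered_field \<Rightarrow> 'f::comm_ring_1 \<Rightarrow> 'f"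
    and der :: "'f \<Rightarrow> 'f" and intg :: "'f \<Rightarrow> 'f"
    and M :: "('f, 'm, 'x) module_scheme" and D :: "'m \<Rightarrow> 'm" and I :: "'m \<Rightarrow> 'm"
    and N :: "('f, 'n, 'y) module_scheme" and D' :: "'n \<Rightarrow> 'n" and J :: "'n \<Rightarrow> 'n"
    and h :: "'m \<Rightarrow> 'n" +
  assumes linear: "linear_on_modules M N h"
    and commutes_D: "commutes_on M D D' h"
    and commutes_I: "commutes_on M I J h"

section \<open>Free modules and quotient modules\<close>

definition free_scale :: "'f \<Rightarrow> ('g \<Rightarrow>\<^sub>0 'f) \<Rightarrow> ('g \<Rightarrow>\<^sub>0 'f::comm_ring_1)" where
  "free_scale f p = Poly_Mapping.map ((*) f) p"

text \<open>Module records extend ring records; the multiplicative fields of a plain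
  module are never used and left \<open>undefined\<close>.\<close>

definition free_module :: "('f::comm_ring_1, 'g \<Rightarrow>\<^sub>0 'f) module" where
  "free_module =
     \<lparr>carrier = UNIV, monoid.mult = undefined, one = undefined, zero = 0, add = (+), module.smult = free_scale\<rparr>"

text \<open>The additive map determined by \<open>f g \<mapsto> T g f\<close> on multiples of basis elements, for \<open>T g\<close> additive.\<close>

definition free_extend :: "('g \<Rightarrow> 'f \<Rightarrow> 'b) \<Rightarrow> ('g \<Rightarrow>\<^sub>0 'f::zero) \<Rightarrow> 'b::comm_monoid_add" where
  "free_extend T p = (\<Sum>g\<in>Poly_Mapping.keys p. T g (Poly_Mapping.lookup p g))"

text \<open>As in the library's quotient rings, the operations on cosets take the union over all
  representatives, so that no choice is made.\<close>

definition quotient_module :: "('f, 'm, 'x) module_scheme \<Rightarrow> 'm set \<Rightarrow> ('f, 'm set) module" where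
  "quotient_module M N =
     \<lparr>carrier = a_rcosets\<^bsub>M\<^esub> N, monoid.mult = undefined, one = undefined, zero = N,
      add = set_add M, module.smult = (\<lambda>f C. \<Union>x\<in>C. N +>\<^bsub>M\<^esub> (f \<odot>\<^bsub>M\<^esub> x))\<rparr>"

definition induced_map :: "('f, 'm, 'x) module_scheme \<Rightarrow> 'm set \<Rightarrow> ('m \<Rightarrow> 'm) \<Rightarrow> 'm set \<Rightarrow> 'm set" where
  "induced_map M N T C = (\<Union>x\<in>C. N +>\<^bsub>M\<^esub> T x)"

section \<open>Piecewise extension and distribution module\<close>

datatype 'k pw_gen = POne | PStep 'k

text \<open>\<open>Step a k\<close> stands for the \<open>k\<close>-th derivative of \<open>H\<^sub>a\<close>; hence \<open>\<delta>\<^sub>a\<close> and its \<open>k\<close>-th derivative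
  are \<open>Step a 1\<close> and \<open>Step a (Suc k)\<close>.\<close>

datatype 'k dist_gen = One | Step 'k nat

abbreviation pw_module :: "('f::comm_ring_1, 'k pw_gen \<Rightarrow>\<^sub>0 'f) module" where
  "pw_module \<equiv> free_module"

abbreviation dist_free :: "('f::comm_ring_1, 'k dist_gen \<Rightarrow>\<^sub>0 'f) module" where
  "dist_free \<equiv> free_module"

primrec pw_to_dist_gen :: "'k pw_gen \<Rightarrow> 'k dist_gen" where
  "pw_to_dist_gen POne = One"
| "pw_to_dist_gen (PStep a) = Step a 0"

definition pw_to_dist :: "('k pw_gen \<Rightarrow>\<^sub>0 'f) \<Rightarrow> ('k dist_gen \<Rightarrow>\<^sub>0 'f::comm_ring_1)" where
  "pw_to_dist = free_extend (\<lambda>g f. Poly_Mapping.single (pw_to_dist_gen g) f)"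

context ordinary_shifted_integro_differential_algebra
begin

primrec pw_int_gen :: "'k pw_gen \<Rightarrow> 'f \<Rightarrow> ('k pw_gen \<Rightarrow>\<^sub>0 'f)" where
  "pw_int_gen POne f = Poly_Mapping.single POne (intg f)"
| "pw_int_gen (PStep a) f =
     Poly_Mapping.single (PStep a) (intg_from a f) +
     Poly_Mapping.single POne (scaleK (coheaviside a) (intg_between 0 a f))"

definition pw_int :: "('k pw_gen \<Rightarrow>\<^sub>0 'f) \<Rightarrow> ('k pw_gen \<Rightarrow>\<^sub>0 'f)" where
  "pw_int = free_extend pw_int_gen"

primrec free_der_gen :: "'k dist_gen \<Rightarrow> 'f \<Rightarrow> ('k dist_gen \<Rightarrow>\<^sub>0 'f)" where
  "free_der_gen One f = Poly_Mapping.single One (der f)"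
| "free_der_gen (Step a k) f =
     Poly_Mapping.single (Step a k) (der f) + Poly_Mapping.single (Step a (Suc k)) f"

definition free_der :: "('k dist_gen \<Rightarrow>\<^sub>0 'f) \<Rightarrow> ('k dist_gen \<Rightarrow>\<^sub>0 'f)" where
  "free_der = free_extend free_der_gen"

text \<open>The differential submodule generated by all \<open>f \<delta>\<^sub>a - e\<^sub>a(f) \<delta>\<^sub>a\<close>.\<close>

definition dist_null :: "('k dist_gen \<Rightarrow>\<^sub>0 'f) set" where
  "dist_null = \<Inter>{N. submodule N ring_of_type_algebra dist_free \<and> (\<forall>p\<in>N. free_der p \<in> N) \<and>
     (\<forall>a f. Poly_Mapping.single (Step a 1) f - Poly_Mapping.single (Step a 1) (eval_at a f) \<in> N)}"

text \<open>\<open>free_int_delta a k f\<close> represents the integral of \<open>f\<close> times the \<open>k\<close>-th derivative of \<open>\<delta>\<^sub>a\<close>.\<close>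

primrec free_int_delta :: "'k \<Rightarrow> nat \<Rightarrow> 'f \<Rightarrow> ('k dist_gen \<Rightarrow>\<^sub>0 'f)" where
  "free_int_delta a 0 f =
     free_scale (eval_at a f)
       (Poly_Mapping.single (Step a 0) 1 - Poly_Mapping.single One (scaleK (coheaviside a) 1))"
| "free_int_delta a (Suc k) f =
     Poly_Mapping.single (Step a (Suc k)) f - free_int_delta a k (der f)"

fun free_int_gen :: "'k dist_gen \<Rightarrow> 'f \<Rightarrow> ('k dist_gen \<Rightarrow>\<^sub>0 'f)" where
  "free_int_gen One f = pw_to_dist (pw_int (Poly_Mapping.single POne f))"
| "free_int_gen (Step a 0) f = pw_to_dist (pw_int (Poly_Mapping.single (PStep a) f))"
| "free_int_gen (Step a (Suc k)) f = free_int_delta a k f"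

definition free_int :: "('k dist_gen \<Rightarrow>\<^sub>0 'f) \<Rightarrow> ('k dist_gen \<Rightarrow>\<^sub>0 'f)" where
  "free_int = free_extend free_int_gen"

definition dist_module :: "('f, ('k dist_gen \<Rightarrow>\<^sub>0 'f) set) module" where
  "dist_module = quotient_module dist_free dist_null"

definition dist_der :: "('k dist_gen \<Rightarrow>\<^sub>0 'f) set \<Rightarrow> ('k dist_gen \<Rightarrow>\<^sub>0 'f) set" where
  "dist_der = induced_map dist_free dist_null free_der"

definition dist_int :: "('k dist_gen \<Rightarrow>\<^sub>0 'f) set \<Rightarrow> ('k dist_gen \<Rightarrow>\<^sub>0 'f) set" where
  "dist_int = induced_map dist_free dist_null free_int"

definition dist_embed :: "('k pw_gen \<Rightarrow>\<^sub>0 'f) \<Rightarrow> ('k dist_gen \<Rightarrow>\<^sub>0 'f) set" where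
  "dist_embed p = dist_null +>\<^bsub>dist_free\<^esub> pw_to_dist p"

end

section \<open>Dirac modules\<close>

locale dirac_module =
  A: ordinary_shifted_integro_differential_algebra scaleK der intg S +
  integro_differential_module scaleK der intg M D I +
  emb: rota_baxter_hom scaleK intg pw_module A.pw_int M I \<kappa>
  for scaleK :: "'k::linordered_field \<Rightarrow> 'f::comm_ring_1 \<Rightarrow> 'f"
    and der :: "'f \<Rightarrow> 'f" and intg :: "'f \<Rightarrow> 'f" and S :: "'k \<Rightarrow> 'f \<Rightarrow> 'f"
    and M :: "('f, 'm, 'x) module_scheme" (structure) and D :: "'m \<Rightarrow> 'm" and I :: "'m \<Rightarrow> 'm"
    and \<kappa> :: "('k pw_gen \<Rightarrow>\<^sub>0 'f) \<Rightarrow> 'm" +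
  fixes step :: "'k \<Rightarrow> 'm" and costep :: "'k \<Rightarrow> 'm" and delta :: "'k \<Rightarrow> nat \<Rightarrow> 'm"
  defines "step a \<equiv> \<kappa> (Poly_Mapping.single (PStep a) 1)"
    and "costep a \<equiv> scaleK (coheaviside a) 1 \<odot>\<^bsub>M\<^esub> \<kappa> (Poly_Mapping.single POne 1)"
    and "delta a k \<equiv> (D ^^ k) (D (step a))"
  assumes \<kappa>_inj: "inj \<kappa>"
    and smult_delta: "f \<odot>\<^bsub>M\<^esub> delta a 0 = A.eval_at a f \<odot>\<^bsub>M\<^esub> delta a 0"
    and I_delta_0: "I (delta a 0) = step a \<ominus>\<^bsub>M\<^esub> costep a"
    and I_delta_Suc: "I (delta a (Suc k)) = delta a k"

end

theory Submission
  imports Defs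
begin

text \<open>
  Write \<open>e\<close> for the evaluation \<open>1 - \<integral>\<partial>\<close> of the algebra \<open>\<F>\<close>, \<open>e\<^sub>a\<close> for the evaluation at \<open>a\<close>, and
  \<open>E = 1 - I D\<close> for the evaluation of a module. The guiding observation is that the Rota-Baxter
  identity follows from the much simpler rule \<open>E (f \<phi>) = e(f) E \<phi>\<close>: since \<open>e\<close> vanishes on
  integrals, \<open>(\<integral>f) \<cdot> I \<phi>\<close> has evaluation \<open>0\<close>, so it is the integral of its own derivative
  \<open>f I \<phi> + (\<integral>f) \<phi>\<close>.

  On the free module on \<open>1\<close> and the \<open>H\<^sub>a\<^sup>(\<^sup>k\<^sup>)\<close>, integration by parts is built into the definition of
  the integral, so \<open>E\<close> takes a closed form there: it sends \<open>f\<close> to \<open>e(f)\<close>, \<open>f H\<^sub>a\<close> to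
  \<open>e(f)\<close> times the value \<open>1\<close> or \<open>0\<close> of the coheaviside function at \<open>a\<close>, and kills every multiple
  of a derivative of \<open>H\<^sub>a\<close> (\<open>free_E_One\<close>, \<open>free_E_Step_zero\<close>, \<open>free_E_Step_Suc\<close>). The rule for \<open>E\<close>
  thus holds before any relation is imposed (\<open>free_E_scale\<close>), because \<open>e\<close> is multiplicative.
  What does need the relations \<open>f \<delta>\<^sub>a = e\<^sub>a(f) \<delta>\<^sub>a\<close> is \<open>D I = 1\<close> (\<open>free_der_free_int\<close>).

  The integral descends to the quotient since \<open>E\<close> vanishes on the relations, which lets one
  integrate a derived relation by parts (\<open>dist_null_free_int\<close>). The relations involve only
  derivatives of the \<open>H\<^sub>a\<close> (\<open>lookup_dist_null\<close>), so the piecewise extension embeds. It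
  inherits its Rota-Baxter identity from the quotient along this embedding.

  For the universal property, the images of \<open>1\<close> and \<open>H\<^sub>a\<close> are prescribed by the embedding and those
  of the \<open>H\<^sub>a\<^sup>(\<^sup>k\<^sup>)\<close> by commutation with \<open>D\<close>, which gives uniqueness. Conversely the linear map with
  these values commutes with \<open>D\<close> once the image of \<open>1\<close> is known to have derivative \<open>0\<close>; this
  follows by differentiating \<open>I \<delta>\<^sub>0 = H\<^sub>0 - 1\<close> (\<open>D_\<kappa>_one\<close>). It then respects the relations, and it
  commutes with the integral because in a Dirac module the integrals of all \<open>f \<delta>\<^sub>a\<^sup>(\<^sup>k\<^sup>)\<close> are forced
  by \<open>E \<delta>\<^sub>a\<^sup>(\<^sup>k\<^sup>) = 0\<close> (\<open>lift_free_int_delta\<close>).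
\<close>

section \<open>Evaluations in integro-differential algebras\<close>

context integro_differential_algebra
begin

lemma additive_der: "additive der" and additive_intg: "additive intg"
  using der_linear intg_linear by (simp_all add: additive_def Vector_Spaces.linear_iff)

lemmas der_add = additive.add[OF additive_der] and der_diff = additive.diff[OF additive_der]
  and der_zero = additive.zero[OF additive_der]

lemmas intg_add = additive.add[OF additive_intg] and intg_zero = additive.zero[OF additive_intg]

lemma der_one: "der 1 = 0"
  using der_mult[of 1 1] by simp

lemma scaleK_eq_mult: "scaleK c f = scaleK c 1 * f"
  using scaleK_mult_left[of c 1 f] by simp

lemma der_scaleK_one: "der (scaleK c 1) = 0"
  using der_linear by (simp add: Vector_Spaces.linear_iff der_one)

lemma der_mult_const: "der c = 0 \<Longrightarrow> der (c * f) = c * der f"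
  by (simp add: der_mult)

text \<open>Integration by parts leaves no second term when the first factor is a constant.\<close>

lemma intg_mult_const: "der c = 0 \<Longrightarrow> intg (c * f) = c * intg f"
  using intg_by_parts[of c f] by (simp add: intg_zero)

lemma der_eval0: "der (eval0 f) = 0"
  by (simp add: eval0_def der_diff der_intg)

lemma eval0_const: "der f = 0 \<Longrightarrow> eval0 f = f"
  by (simp add: eval0_def intg_zero)

lemma additive_eval0: "additive eval0"
  by (simp add: additive_def eval0_def der_add intg_add)

lemma eval0_mult_const: "der c = 0 \<Longrightarrow> eval0 (c * f) = c * eval0 f"
  by (simp add: eval0_def der_mult_const intg_mult_const right_diff_distrib)

lemma eval0_intg: "eval0 (intg f) = 0"
  by (simp add: eval0_def der_intg)

text \<open>Integration by parts says that a product with an integral evaluates to zero. Splitting the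
  second factor as \<open>g = eval0 g + intg (der g)\<close> then gives multiplicativity.\<close>

lemma eval0_mult: "eval0 (f * g) = eval0 f * eval0 g"
proof -
  have vanish: "eval0 (f * intg h) = 0" for h
  proof -
    have "intg (der (f * intg h)) = f * intg h"
      by (simp add: der_mult der_intg intg_add intg_by_parts[of f h, symmetric] add.commute)
    then show ?thesis
      by (simp add: eval0_def)
  qed
  have "f * g = eval0 g * f + f * intg (der g)"
    by (simp add: eval0_def algebra_simps)
  then show ?thesis
    by (simp add: additive.add[OF additive_eval0] vanish eval0_mult_const der_eval0)
qed

end

context ordinary_shifted_integro_differential_algebra
begin

lemma constant_scaleK: "der f = 0 \<Longrightarrow> \<exists>c. f = scaleK c 1"
  using ordinary by auto

lemma additive_shift: "additive (S c)"
  using shift_linear[of c] by (simp add: additive_def Vector_Spaces.linear_iff)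

text \<open>The constants are the multiples of \<open>1\<close>, on which an automorphism over \<open>K\<close> acts trivially.\<close>

lemma shift_const:
  assumes "der f = 0"
  shows "S c f = f"
proof -
  obtain k where k: "f = scaleK k 1"
    using constant_scaleK assms by blast
  have "S c (scaleK k 1) = scaleK k (S c 1)"
    using shift_linear[of c] by (simp add: Vector_Spaces.linear_iff)
  then show ?thesis
    by (simp add: k shift_one)
qed

lemma shift_zero: "S 0 f = f"
proof -
  have "S 0 (S 0 f) = S 0 f"
    using shift_hom[of 0 0] by (metis add_0 comp_apply)
  then show ?thesis
    using shift_bij[of 0] by (meson bij_is_inj injD)
qed

lemma additive_eval_at: "additive (eval_at a)"
  using additive.add[OF additive_shift] additive.add[OF additive_eval0]
  by (simp add: additive_def eval_at_def)

lemmas eval_at_add = additive.add[OF additive_eval_at]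
  and eval_at_diff = additive.diff[OF additive_eval_at]

lemma eval_at_const: "der f = 0 \<Longrightarrow> eval_at a f = f"
  by (simp add: eval_at_def shift_const eval0_const)

lemma der_eval_at: "der (eval_at a f) = 0"
  by (simp add: eval_at_def der_eval0)

lemma eval_at_mult: "eval_at a (f * g) = eval_at a f * eval_at a g"
  by (simp add: eval_at_def shift_mult eval0_mult)

lemma eval_at_mult_const: "der c = 0 \<Longrightarrow> eval_at a (c * f) = c * eval_at a f"
  by (simp add: eval_at_mult eval_at_const)

lemma eval_at_one: "eval_at a 1 = 1"
  by (simp add: eval_at_const der_one)

lemma intg_between_zero: "intg_between 0 a f = eval_at a (intg f)"
  by (simp add: intg_between_def intg_from_def eval_at_def[of 0] shift_zero eval0_intg)

text \<open>The integral starts at \<open>0\<close>; this is the fundamental theorem of calculus, evaluated at \<open>a\<close>.\<close>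

lemma eval_at_intg_der: "eval_at a (intg (der f)) = eval_at a f - eval0 f"
proof -
  have "intg (der f) = f - eval0 f"
    by (simp add: eval0_def)
  then show ?thesis
    by (simp add: eval_at_diff eval_at_const der_eval0)
qed

end

section \<open>Free modules\<close>

lemma lookup_free_scale [simp]:
  "Poly_Mapping.lookup (free_scale f p) g = f * Poly_Mapping.lookup p g"
  by (simp add: free_scale_def Poly_Mapping.map.rep_eq when_def)

lemma free_scale_add: "free_scale f (p + q) = free_scale f p + free_scale f q"
  and free_scale_diff: "free_scale f (p - q) = free_scale f p - free_scale f q"
  and free_scale_add_left: "free_scale (f + f') p = free_scale f p + free_scale f' p"
  and free_scale_diff_left: "free_scale (f - f') p = free_scale f p - free_scale f' p"
  and free_scale_mult: "free_scale (f * f') p = free_scale f (free_scale f' p)"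
  and free_scale_zero [simp]: "free_scale f 0 = 0"
  and free_scale_zero_left [simp]: "free_scale 0 p = 0"
  and free_scale_one [simp]: "free_scale 1 p = p"
  and free_scale_minus_one: "free_scale (- 1) p = - p"
  by (rule poly_mapping_eqI; simp add: lookup_add lookup_minus algebra_simps)+

lemma free_scale_single [simp]:
  "free_scale f (Poly_Mapping.single g f') = Poly_Mapping.single g (f * f')"
  by (rule poly_mapping_eqI) (simp add: lookup_single when_def)

lemma additive_single: "additive (Poly_Mapping.single g)"
  by (simp add: additive_def single_add)

lemma sum_single_lookup:
  "(\<Sum>g\<in>Poly_Mapping.keys p. Poly_Mapping.single g (Poly_Mapping.lookup p g)) = p"
  by (rule poly_mapping_eqI) (auto simp: lookup_sum lookup_single when_def in_keys_iff sum.delta)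

lemma poly_mapping_induct_add [case_names single add]:
  assumes single: "\<And>g f. P (Poly_Mapping.single g f)"
    and add: "\<And>p q. P p \<Longrightarrow> P q \<Longrightarrow> P (p + q)"
  shows "P (p :: 'g \<Rightarrow>\<^sub>0 'f::comm_monoid_add)"
proof -
  have "P (\<Sum>g\<in>A. Poly_Mapping.single g (Poly_Mapping.lookup p g))" if "finite A" for A
    using that
  proof (induction A rule: finite_induct)
    case empty
    then show ?case using single[of undefined 0] by simp
  next
    case (insert g A)
    then show ?case by (simp add: add single)
  qed
  from this[OF finite_keys[of p]] show ?thesis
    by (simp only: sum_single_lookup)
qed

lemma
  fixes T :: "'g \<Rightarrow> 'f::ab_group_add \<Rightarrow> 'b::ab_group_add"
  assumes T: "\<And>g. additive (T g)"
  shows additive_free_extend: "additive (free_extend T)"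
    and free_extend_single: "free_extend T (Poly_Mapping.single g f) = T g f"
proof -
  have "free_extend T (p + q) = free_extend T p + free_extend T q" for p q
    unfolding free_extend_def
    by (rule setsum_keys_plus_distrib) (simp_all add: T additive.zero additive.add)
  then show "additive (free_extend T)"
    by (simp add: additive_def)
  show "free_extend T (Poly_Mapping.single g f) = T g f"
    by (simp add: free_extend_def additive.zero[OF T])
qed

lemma free_module_simps [simp]:
  "carrier free_module = UNIV" "zero free_module = 0" "add free_module = (+)"
  "module.smult free_module = free_scale"
  by (simp_all add: free_module_def)

lemma ring_of_type_algebra_simps [simp]:
  "carrier ring_of_type_algebra = UNIV" "one ring_of_type_algebra = 1"
  "zero ring_of_type_algebra = 0" "add ring_of_type_algebra = (+)"
  "monoid.mult ring_of_type_algebra = (*)"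
  by (simp_all add: ring_of_type_algebra_def)

lemma module_free_module: "module ring_of_type_algebra free_module"
proof (rule moduleI)
  show "abelian_group free_module"
  proof (rule abelian_groupI)
    show "\<exists>q\<in>carrier free_module. q \<oplus>\<^bsub>free_module\<^esub> p = \<zero>\<^bsub>free_module\<^esub>" for p :: "'g \<Rightarrow>\<^sub>0 'f::comm_ring_1"
      by (simp add: exI[of _ "- p"])
  qed (simp_all add: ac_simps)
qed (simp_all add: cring_from_type_algebra free_scale_add free_scale_add_left free_scale_mult)

interpretation free: module ring_of_type_algebra free_module
  by (rule module_free_module)

lemma a_inv_free_module [simp]: "a_inv free_module p = - p"
  by (rule free.M.minus_equality) simp_all

lemma a_minus_free_module [simp]: "a_minus free_module p q = p - q"
  by (simp add: a_minus_def)

lemma submodule_free_module_iff: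
  "submodule N ring_of_type_algebra free_module \<longleftrightarrow>
     0 \<in> N \<and> (\<forall>p\<in>N. \<forall>q\<in>N. p + q \<in> N) \<and> (\<forall>f. \<forall>p\<in>N. free_scale f p \<in> N)"
proof
  assume "submodule N ring_of_type_algebra free_module"
  then interpret submodule N ring_of_type_algebra free_module .
  show "0 \<in> N \<and> (\<forall>p\<in>N. \<forall>q\<in>N. p + q \<in> N) \<and> (\<forall>f. \<forall>p\<in>N. free_scale f p \<in> N)"
    using m_closed one_closed smult_closed by simp
next
  assume N: "0 \<in> N \<and> (\<forall>p\<in>N. \<forall>q\<in>N. p + q \<in> N) \<and> (\<forall>f. \<forall>p\<in>N. free_scale f p \<in> N)"
  then have "- p \<in> N" if "p \<in> N" for p
    using that free_scale_minus_one by metis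
  with N show "submodule N ring_of_type_algebra free_module"
    by (intro free.submoduleI) simp_all
qed

text \<open>The target has an explicit carrier, so its sums are not those of a type class as in
  \<open>free_extend\<close>.\<close>

definition module_extend ::
  "('f::comm_ring_1, 'm, 'x) module_scheme \<Rightarrow> ('g \<Rightarrow> 'm) \<Rightarrow> ('g \<Rightarrow>\<^sub>0 'f) \<Rightarrow> 'm" where
  "module_extend M b p =
     (\<Oplus>\<^bsub>M\<^esub>g\<in>Poly_Mapping.keys p. Poly_Mapping.lookup p g \<odot>\<^bsub>M\<^esub> b g)"

locale module_basis_map = module ring_of_type_algebra M
  for M :: "('f::comm_ring_1, 'm, 'x) module_scheme" (structure) +
  fixes b :: "'g \<Rightarrow> 'm"
  assumes b_closed [simp]: "b g \<in> carrier M"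
begin

lemma module_extend_closed [simp]: "module_extend M b p \<in> carrier M"
  unfolding module_extend_def by (rule M.finsum_closed) simp

lemma module_extend_superset:
  assumes "finite A" "Poly_Mapping.keys p \<subseteq> A"
  shows "module_extend M b p = (\<Oplus>\<^bsub>M\<^esub>g\<in>A. Poly_Mapping.lookup p g \<odot>\<^bsub>M\<^esub> b g)"
  unfolding module_extend_def using assms smult_l_null
  by (intro M.add.finprod_mono_neutral_cong_left) (auto simp: in_keys_iff)

lemma module_extend_add:
  "module_extend M b (p + q) = module_extend M b p \<oplus>\<^bsub>M\<^esub> module_extend M b q"
proof -
  let ?A = "Poly_Mapping.keys p \<union> Poly_Mapping.keys q"
  have "module_extend M b (p + q) =
      (\<Oplus>\<^bsub>M\<^esub>g\<in>?A. Poly_Mapping.lookup p g \<odot>\<^bsub>M\<^esub> b g \<oplus>\<^bsub>M\<^esub> Poly_Mapping.lookup q g \<odot>\<^bsub>M\<^esub> b g)"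
    using module_extend_superset[of ?A "p + q"] keys_add[of p q] smult_l_distr
    by (simp add: lookup_add)
  also have "\<dots> = module_extend M b p \<oplus>\<^bsub>M\<^esub> module_extend M b q"
    using module_extend_superset[of ?A p] module_extend_superset[of ?A q]
    by (simp add: M.finsum_addf)
  finally show ?thesis .
qed

lemma module_extend_single: "module_extend M b (Poly_Mapping.single g f) = f \<odot>\<^bsub>M\<^esub> b g"
proof -
  have "module_extend M b (Poly_Mapping.single g f) =
      (\<Oplus>\<^bsub>M\<^esub>h\<in>{g}. Poly_Mapping.lookup (Poly_Mapping.single g f) h \<odot>\<^bsub>M\<^esub> b h)"
    by (rule module_extend_superset) (simp_all add: keys_single)
  then show ?thesis
    by simp
qed

lemma module_extend_scale: "module_extend M b (free_scale f p) = f \<odot>\<^bsub>M\<^esub> module_extend M b p"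
proof (induction p rule: poly_mapping_induct_add)
  case (single g h)
  then show ?case
    using smult_assoc1[of f h "b g"] by (simp add: module_extend_single)
next
  case (add p q)
  then show ?case
    using smult_r_distr[of f "module_extend M b p" "module_extend M b q"]
    by (simp add: free_scale_add module_extend_add)
qed

lemma module_extend_zero: "module_extend M b 0 = \<zero>\<^bsub>M\<^esub>"
  by (simp add: module_extend_def)

lemma module_extend_diff:
  "module_extend M b (p - q) = module_extend M b p \<ominus>\<^bsub>M\<^esub> module_extend M b q"
proof -
  have "module_extend M b p = module_extend M b (p - q) \<oplus>\<^bsub>M\<^esub> module_extend M b q"
    by (simp flip: module_extend_add)
  then show ?thesis
    by (simp add: a_minus_def M.a_assoc M.r_neg)
qed

lemma linear_module_extend: "linear_on_modules free_module M (module_extend M b)"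
  by (simp add: linear_on_modules_def module_extend_add module_extend_scale)

end

lemma linear_on_free_module_eqI:
  assumes "linear_on_modules free_module M h" "linear_on_modules free_module M h'"
    and "\<And>g. h (Poly_Mapping.single g 1) = h' (Poly_Mapping.single g 1)"
  shows "h p = h' p"
proof (induction p rule: poly_mapping_induct_add)
  case (single g f)
  have "h (free_scale f (Poly_Mapping.single g 1)) = h' (free_scale f (Poly_Mapping.single g 1))"
    using assms by (simp add: linear_on_modules_def del: free_scale_single)
  then show ?case
    by simp
next
  case (add p q)
  then show ?case
    using assms by (simp add: linear_on_modules_def)
qed

section \<open>Quotient modules\<close>

locale module_quotient = module R M for R (structure) and M (structure) +
  fixes N :: "'c set"
  assumes submodule: "submodule N R M"
begin

abbreviation proj :: "'c \<Rightarrow> 'c set" where "proj x \<equiv> N +>\<^bsub>M\<^esub> x"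

abbreviation Q where "Q \<equiv> quotient_module M N"

sublocale subgroup: abelian_subgroup N M
  by (intro abelian_subgroupI3 additive_subgroupI submodule.axioms(1)[OF submodule])
    (rule abelian_group_axioms)

lemma proj_eq_iff:
  assumes "x \<in> carrier M" "y \<in> carrier M"
  shows "proj x = proj y \<longleftrightarrow> x \<ominus>\<^bsub>M\<^esub> y \<in> N"
proof -
  have "proj x = proj y \<longleftrightarrow> x \<in> proj y"
    using assms subgroup.a_rcos_self[of x] subgroup.a_repr_independence'[of x y] by auto
  then show ?thesis
    using assms by (simp add: subgroup.a_rcos_module a_minus_def)
qed

lemma carrier_quotient: "carrier Q = proj ` carrier M"
  by (auto simp: quotient_module_def A_RCOSETS_def')

lemma proj_closed: "x \<in> carrier M \<Longrightarrow> proj x \<in> carrier Q"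
  by (simp add: carrier_quotient)

lemma proj_add:
  "x \<in> carrier M \<Longrightarrow> y \<in> carrier M \<Longrightarrow> proj x \<oplus>\<^bsub>Q\<^esub> proj y = proj (x \<oplus>\<^bsub>M\<^esub> y)"
  by (simp add: quotient_module_def subgroup.a_rcos_sum)

lemma zero_quotient: "\<zero>\<^bsub>Q\<^esub> = proj \<zero>\<^bsub>M\<^esub>"
  by (simp add: quotient_module_def subgroup.a_rcos_const)

text \<open>Over one coset the union in the definition of \<open>induced_map\<close> runs over equal sets.\<close>

lemma induced_map_proj:
  assumes x: "x \<in> carrier M"
    and T: "\<And>y. y \<in> carrier M \<Longrightarrow> T y \<in> carrier M"
      "\<And>y z. y \<in> carrier M \<Longrightarrow> z \<in> carrier M \<Longrightarrow> T (y \<oplus>\<^bsub>M\<^esub> z) = T y \<oplus>\<^bsub>M\<^esub> T z"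
      "\<And>y. y \<in> N \<Longrightarrow> T y \<in> N"
  shows "induced_map M N T (proj x) = proj (T x)"
proof -
  have "proj (T y) = proj (T x)" if y: "y \<in> proj x" for y
  proof -
    obtain n where n: "n \<in> N" "y = n \<oplus>\<^bsub>M\<^esub> x"
      using y by (auto simp: a_r_coset_def')
    then have nM: "n \<in> carrier M"
      using subgroup.a_subset by blast
    have "T y \<ominus>\<^bsub>M\<^esub> T x = T n"
      using n nM x T by (simp add: a_minus_def M.a_assoc M.r_neg)
    then show ?thesis
      using n nM x T by (simp add: proj_eq_iff)
  qed
  then have "induced_map M N T (proj x) = (\<Union>y\<in>proj x. proj (T x))"
    unfolding induced_map_def by (rule SUP_cong[OF refl])
  also have "\<dots> = proj (T x)"
    using subgroup.a_rcos_self[OF x] by (intro UN_constant_eq) simp_all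
  finally show ?thesis .
qed

lemma smult_proj:
  assumes "f \<in> carrier R" "x \<in> carrier M"
  shows "f \<odot>\<^bsub>Q\<^esub> proj x = proj (f \<odot>\<^bsub>M\<^esub> x)"
proof -
  have "f \<odot>\<^bsub>Q\<^esub> proj x = induced_map M N (\<lambda>x. f \<odot>\<^bsub>M\<^esub> x) (proj x)"
    by (simp add: quotient_module_def induced_map_def)
  also have "\<dots> = proj (f \<odot>\<^bsub>M\<^esub> x)"
    using assms submodule.smult_closed[OF submodule]
    by (intro induced_map_proj) (simp_all add: smult_r_distr)
  finally show ?thesis .
qed

lemma module_quotient: "module R Q"
proof (rule moduleI)
  show "abelian_group Q"
  proof (rule abelian_groupI)
    fix A B C
    assume "A \<in> carrier Q" "B \<in> carrier Q" "C \<in> carrier Q"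
    then obtain x y z where xyz: "x \<in> carrier M" "y \<in> carrier M" "z \<in> carrier M"
      and eq: "A = proj x" "B = proj y" "C = proj z"
      unfolding carrier_quotient by blast
    show "A \<oplus>\<^bsub>Q\<^esub> B \<in> carrier Q"
      using xyz by (simp add: eq proj_add proj_closed)
    show "A \<oplus>\<^bsub>Q\<^esub> B \<oplus>\<^bsub>Q\<^esub> C = A \<oplus>\<^bsub>Q\<^esub> (B \<oplus>\<^bsub>Q\<^esub> C)"
      using xyz by (simp add: eq proj_add M.a_assoc)
    show "A \<oplus>\<^bsub>Q\<^esub> B = B \<oplus>\<^bsub>Q\<^esub> A"
      using xyz by (simp add: eq proj_add M.a_comm)
    show "\<zero>\<^bsub>Q\<^esub> \<oplus>\<^bsub>Q\<^esub> A = A"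
      using xyz by (simp add: eq proj_add zero_quotient)
    show "\<exists>B\<in>carrier Q. B \<oplus>\<^bsub>Q\<^esub> A = \<zero>\<^bsub>Q\<^esub>"
      using xyz by (intro bexI[of _ "proj (\<ominus>\<^bsub>M\<^esub> x)"])
        (simp_all add: eq proj_add proj_closed M.l_neg zero_quotient)
  qed (simp add: zero_quotient proj_closed)
next
  fix f g A B
  assume fg: "f \<in> carrier R" "g \<in> carrier R" and "A \<in> carrier Q" "B \<in> carrier Q"
  then obtain x y where xy: "x \<in> carrier M" "y \<in> carrier M" and eq: "A = proj x" "B = proj y"
    unfolding carrier_quotient by blast
  show "f \<odot>\<^bsub>Q\<^esub> A \<in> carrier Q"
    using fg xy by (simp add: eq smult_proj proj_closed)
  show "(f \<oplus> g) \<odot>\<^bsub>Q\<^esub> A = f \<odot>\<^bsub>Q\<^esub> A \<oplus>\<^bsub>Q\<^esub> g \<odot>\<^bsub>Q\<^esub> A"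
    using fg xy by (simp add: eq smult_proj proj_add smult_l_distr)
  show "f \<odot>\<^bsub>Q\<^esub> (A \<oplus>\<^bsub>Q\<^esub> B) = f \<odot>\<^bsub>Q\<^esub> A \<oplus>\<^bsub>Q\<^esub> f \<odot>\<^bsub>Q\<^esub> B"
    using fg xy by (simp add: eq smult_proj proj_add smult_r_distr)
  show "(f \<otimes> g) \<odot>\<^bsub>Q\<^esub> A = f \<odot>\<^bsub>Q\<^esub> (g \<odot>\<^bsub>Q\<^esub> A)"
    using fg xy by (simp add: eq smult_proj smult_assoc1)
next
  fix A
  assume "A \<in> carrier Q"
  then obtain x where "x \<in> carrier M" "A = proj x"
    unfolding carrier_quotient by blast
  then show "\<one> \<odot>\<^bsub>Q\<^esub> A = A"
    by (simp add: smult_proj)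
qed (rule R.cring_axioms)

lemma proj_minus:
  assumes "x \<in> carrier M" "y \<in> carrier M"
  shows "proj x \<ominus>\<^bsub>Q\<^esub> proj y = proj (x \<ominus>\<^bsub>M\<^esub> y)"
proof -
  interpret Q: module R Q
    by (rule module_quotient)
  have "proj (\<ominus>\<^bsub>M\<^esub> y) \<oplus>\<^bsub>Q\<^esub> proj y = \<zero>\<^bsub>Q\<^esub>"
    using assms by (simp add: proj_add zero_quotient M.l_neg)
  then have "\<ominus>\<^bsub>Q\<^esub> proj y = proj (\<ominus>\<^bsub>M\<^esub> y)"
    using assms by (metis Q.minus_equality M.a_inv_closed proj_closed)
  then show ?thesis
    using assms by (simp add: a_minus_def proj_add)
qed

end

text \<open>For \<open>h\<close> constant on cosets, this is the map that \<open>h\<close> induces on the quotient, made unique as a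
  function by leaving it \<open>undefined\<close> elsewhere.\<close>

definition quotient_lift :: "('f, 'm, 'x) module_scheme \<Rightarrow> 'm set \<Rightarrow> ('m \<Rightarrow> 'n) \<Rightarrow> 'm set \<Rightarrow> 'n" where
  "quotient_lift M N h = (\<lambda>C\<in>carrier (quotient_module M N). the_elem (h ` C))"

lemma (in module_quotient) quotient_lift_proj:
  assumes "\<And>x n. x \<in> carrier M \<Longrightarrow> n \<in> N \<Longrightarrow> h (n \<oplus>\<^bsub>M\<^esub> x) = h x" and x: "x \<in> carrier M"
  shows "quotient_lift M N h (proj x) = h x"
proof -
  have "h ` proj x = {h x}"
    using assms subgroup.a_rcos_self[OF x] by (auto simp: a_r_coset_def' image_iff)
  then show ?thesis
    using x by (simp add: quotient_lift_def proj_closed)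
qed

section \<open>Operators on the free module\<close>

lemma additive_pw_to_dist: "additive pw_to_dist"
  and pw_to_dist_single [simp]:
    "pw_to_dist (Poly_Mapping.single g f) = Poly_Mapping.single (pw_to_dist_gen g) f"
  unfolding pw_to_dist_def
  by (simp_all add: additive_free_extend free_extend_single additive_single)

lemmas pw_to_dist_add = additive.add[OF additive_pw_to_dist]

lemma pw_to_dist_scale: "pw_to_dist (free_scale f p) = free_scale f (pw_to_dist p)"
  by (induction p rule: poly_mapping_induct_add) (simp_all add: pw_to_dist_add free_scale_add)

lemma lookup_pw_to_dist: "Poly_Mapping.lookup (pw_to_dist p) (pw_to_dist_gen g) = Poly_Mapping.lookup p g"
proof -
  have inj: "pw_to_dist_gen h = pw_to_dist_gen g \<longleftrightarrow> h = g" for h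
    by (cases h; cases g) simp_all
  show ?thesis
    by (induction p rule: poly_mapping_induct_add)
      (simp_all add: pw_to_dist_add lookup_add lookup_single when_def inj)
qed

context ordinary_shifted_integro_differential_algebra
begin

abbreviation coheaviside_scalar :: "'k \<Rightarrow> 'f" where
  "coheaviside_scalar a \<equiv> scaleK (coheaviside a) 1"

lemma additive_pw_int_gen: "additive (pw_int_gen g)"
  by (cases g) (simp_all add: additive_def intg_add intg_from_def intg_between_zero eval_at_add
      scaleK_eq_mult[of _ "eval_at _ _ + eval_at _ _"] scaleK_eq_mult[of _ "eval_at _ _"]
      distrib_left single_add single_diff algebra_simps)

lemma additive_pw_int: "additive pw_int"
  and pw_int_single [simp]: "pw_int (Poly_Mapping.single g f) = pw_int_gen g f"
  unfolding pw_int_def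
  by (simp_all add: additive_free_extend free_extend_single additive_pw_int_gen)

lemma additive_free_der_gen: "additive (free_der_gen g)"
  by (cases g) (simp_all add: additive_def der_add single_add algebra_simps)

lemma additive_free_der: "additive free_der"
  and free_der_single [simp]: "free_der (Poly_Mapping.single g f) = free_der_gen g f"
  unfolding free_der_def
  by (simp_all add: additive_free_extend free_extend_single additive_free_der_gen)

lemmas free_der_add = additive.add[OF additive_free_der]
  and free_der_diff = additive.diff[OF additive_free_der]

lemma free_der_scale:
  "free_der (free_scale f p) = free_scale (der f) p + free_scale f (free_der p)"
proof (induction p rule: poly_mapping_induct_add)
  case (single g h)
  then show ?case
    by (cases g) (simp_all add: der_mult single_add free_scale_add algebra_simps)
qed (simp add: free_scale_add free_der_add algebra_simps)

text \<open>The primitive \<open>I \<delta>\<^sub>a\<close> of \<open>\<delta>\<^sub>a\<close>: the step function, shifted down by \<open>1\<close> for \<open>a \<le> 0\<close> so that it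
  vanishes at \<open>0\<close>.\<close>

definition jump :: "'k \<Rightarrow> 'k dist_gen \<Rightarrow>\<^sub>0 'f" where
  "jump a = Poly_Mapping.single (Step a 0) 1 - Poly_Mapping.single One (coheaviside_scalar a)"

lemma free_der_jump: "free_der (jump a) = Poly_Mapping.single (Step a 1) 1"
  by (simp add: jump_def free_der_diff der_one der_scaleK_one)

lemma free_int_delta_zero: "free_int_delta a 0 f = free_scale (eval_at a f) (jump a)"
  by (simp add: jump_def)

(* The closed forms in terms of jump replace the defining equations as rewrite rules. *)
declare free_int_delta.simps(1) [simp del]

lemma additive_free_int_delta: "additive (free_int_delta a k)"
proof (induction k)
  case 0
  show ?case
    by (simp add: additive_def free_int_delta_zero eval_at_add free_scale_add_left)
next
  case (Suc k)
  then show ?case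
    by (simp add: additive_def der_add single_add algebra_simps)
qed

text \<open>Integration by parts: the subtracted term is the integral of \<open>(\<integral>f) \<delta>\<^sub>a\<close>.\<close>

lemma free_int_gen_Step_zero:
  "free_int_gen (Step a 0) f =
     Poly_Mapping.single (Step a 0) (intg f) - free_scale (eval_at a (intg f)) (jump a)"
  by (simp add: pw_to_dist_add jump_def free_scale_diff intg_from_def intg_between_zero
      additive.diff[OF additive_single] additive.diff[OF additive_pw_to_dist]
      scaleK_eq_mult[of _ "eval_at a (intg f)"] mult.commute)

lemma free_int_gen_One: "free_int_gen One f = Poly_Mapping.single One (intg f)"
  by simp

declare free_int_gen.simps(1,2) [simp del]

lemmas free_int_gen_simps [simp] = free_int_gen_One free_int_gen_Step_zero

lemma additive_free_int_gen: "additive (free_int_gen g)"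
proof (cases g)
  case One
  then show ?thesis
    by (simp add: additive_def intg_add single_add)
next
  case (Step a k)
  have "free_int_gen (Step a (Suc l)) = free_int_delta a l" for l
    by (rule ext) simp
  then show ?thesis
    using Step by (cases k) (simp_all add: additive_free_int_delta,
      simp add: additive_def intg_add single_add eval_at_add free_scale_add_left)
qed

lemma additive_free_int: "additive free_int"
  and free_int_single [simp]: "free_int (Poly_Mapping.single g f) = free_int_gen g f"
  unfolding free_int_def
  by (simp_all add: additive_free_extend free_extend_single additive_free_int_gen)

lemmas free_int_add = additive.add[OF additive_free_int]
  and free_int_diff = additive.diff[OF additive_free_int]
  and free_int_zero = additive.zero[OF additive_free_int]

lemma free_int_pw_to_dist: "free_int (pw_to_dist p) = pw_to_dist (pw_int p)"
proof (induction p rule: poly_mapping_induct_add)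
  case (single g f)
  show ?case
    by (cases g) (simp_all add: free_int_gen.simps(1,2) del: free_int_gen_simps pw_int_single)
qed (simp add: free_int_add pw_to_dist_add additive.add[OF additive_pw_int])

lemma free_int_delta_mult_const:
  "der c = 0 \<Longrightarrow> free_int_delta a k (c * f) = free_scale c (free_int_delta a k f)"
  by (induction k arbitrary: f)
    (simp_all add: free_int_delta_zero eval_at_mult_const free_scale_mult der_mult_const free_scale_diff)

lemma free_int_mult_const:
  assumes "der c = 0"
  shows "free_int (free_scale c p) = free_scale c (free_int p)"
proof (induction p rule: poly_mapping_induct_add)
  case (single g f)
  show ?case
  proof (cases g)
    case One
    then show ?thesis by (simp add: assms intg_mult_const)
  next
    case (Step a k)
    then show ?thesis
      by (cases k) (simp_all add: assms free_int_delta_mult_const intg_mult_const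
          eval_at_mult_const free_scale_mult free_scale_diff)
  qed
qed (simp add: free_int_add free_scale_add)

text \<open>The evaluation \<open>1 - I D\<close>, already on the free module. It will turn out to be semilinear along
  \<open>eval0\<close> there, although \<open>D I = 1\<close> only holds up to relations.\<close>

definition free_E :: "('k dist_gen \<Rightarrow>\<^sub>0 'f) \<Rightarrow> ('k dist_gen \<Rightarrow>\<^sub>0 'f)" where
  "free_E p = p - free_int (free_der p)"

lemma additive_free_E: "additive free_E"
  by (simp add: additive_def free_E_def free_int_add free_der_add)

lemma free_E_One: "free_E (Poly_Mapping.single One f) = Poly_Mapping.single One (eval0 f)"
  by (simp add: free_E_def eval0_def single_diff)

text \<open>The contributions of \<open>e\<^sub>a\<close> from \<open>I (f' H\<^sub>a)\<close> and \<open>I (f \<delta>\<^sub>a)\<close> cancel up to \<open>e(f)\<close>.\<close>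

lemma free_E_Step_zero:
  "free_E (Poly_Mapping.single (Step a 0) f) = Poly_Mapping.single One (eval0 f * coheaviside_scalar a)"
proof -
  have "free_E (Poly_Mapping.single (Step a 0) f) =
    Poly_Mapping.single (Step a 0) (eval0 f) + free_scale (eval_at a (intg (der f)) - eval_at a f) (jump a)"
    by (simp add: free_E_def free_int_add free_int_delta_zero eval0_def single_diff free_scale_diff_left)
  also have "\<dots> = Poly_Mapping.single (Step a 0) (eval0 f) - free_scale (eval0 f) (jump a)"
    using free_scale_diff_left[of 0 "eval0 f" "jump a"] by (simp add: eval_at_intg_der)
  finally show ?thesis
    by (simp add: jump_def free_scale_diff)
qed

text \<open>The recursion for the integral of \<open>f \<delta>\<^sub>a\<^sup>(\<^sup>k\<^sup>)\<close> is integration by parts without boundary term.\<close>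

lemma free_E_Step_Suc: "free_E (Poly_Mapping.single (Step a (Suc k)) f) = 0"
  by (simp add: free_E_def free_int_add)

lemma free_E_scale: "free_E (free_scale f p) = free_scale (eval0 f) (free_E p)"
proof (induction p rule: poly_mapping_induct_add)
  case (single g h)
  show ?case
  proof (cases g)
    case One
    then show ?thesis by (simp add: free_E_One eval0_mult)
  next
    case (Step a k)
    then show ?thesis
      by (cases k) (simp_all add: free_E_Step_zero free_E_Step_Suc eval0_mult mult.assoc)
  qed
qed (simp add: additive.add[OF additive_free_E] free_scale_add)

section \<open>The submodule of relations\<close>

text \<open>Induction over the relations: the only source of new ones besides the module operations is
  differentiation.\<close>

lemma dist_null_least:
  assumes "0 \<in> N" "\<And>p q. p \<in> N \<Longrightarrow> q \<in> N \<Longrightarrow> p + q \<in> N" "\<And>f p. p \<in> N \<Longrightarrow> free_scale f p \<in> N"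
    and "\<And>p. p \<in> N \<Longrightarrow> free_der p \<in> N"
    and "\<And>a f. Poly_Mapping.single (Step a 1) (f - eval_at a f) \<in> N"
  shows "dist_null \<subseteq> N"
  unfolding dist_null_def
  by (rule Inter_lower) (use assms in \<open>simp add: submodule_free_module_iff single_diff\<close>)

lemma submodule_dist_null: "submodule dist_null ring_of_type_algebra dist_free"
  by (simp add: submodule_free_module_iff) (auto simp: dist_null_def submodule_free_module_iff)

sublocale dist: module_quotient ring_of_type_algebra dist_free dist_null
  by (intro module_quotient.intro module_free_module module_quotient_axioms.intro submodule_dist_null)

lemma dist_null_zero: "0 \<in> dist_null"
  and dist_null_add: "p \<in> dist_null \<Longrightarrow> q \<in> dist_null \<Longrightarrow> p + q \<in> dist_null"
  and dist_null_scale: "p \<in> dist_null \<Longrightarrow> free_scale f p \<in> dist_null"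
  using submodule_dist_null by (simp_all add: submodule_free_module_iff)

lemma dist_null_uminus: "p \<in> dist_null \<Longrightarrow> - p \<in> dist_null"
  using dist_null_scale[of p "- 1"] by (simp add: free_scale_minus_one)

lemma dist_null_free_der: "p \<in> dist_null \<Longrightarrow> free_der p \<in> dist_null"
  by (simp add: dist_null_def)

lemma dist_null_delta: "Poly_Mapping.single (Step a 1) (f - eval_at a f) \<in> dist_null"
  by (simp add: dist_null_def single_diff)

lemma lookup_free_der_One: "Poly_Mapping.lookup (free_der p) One = der (Poly_Mapping.lookup p One)"
proof (induction p rule: poly_mapping_induct_add)
  case (single g f)
  show ?case
    by (cases g) (simp_all add: lookup_add lookup_single when_def der_zero)
qed (simp add: free_der_add lookup_add der_add)

lemma lookup_free_der_Step_zero: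
  "Poly_Mapping.lookup (free_der p) (Step a 0) = der (Poly_Mapping.lookup p (Step a 0))"
proof (induction p rule: poly_mapping_induct_add)
  case (single g f)
  show ?case
    by (cases g) (simp_all add: lookup_add lookup_single when_def der_zero)
qed (simp add: free_der_add lookup_add der_add)

text \<open>The coordinates at \<open>1\<close> and at the \<open>H\<^sub>a\<close> vanish on the generating relations, and differentiation
  acts on these coordinates separately, so they vanish on all relations. This yields both the
  injectivity of the embedding and the vanishing of \<open>E\<close> on relations.\<close>

lemma lookup_dist_null:
  assumes "p \<in> dist_null"
  shows "Poly_Mapping.lookup p (pw_to_dist_gen g) = 0"
proof -
  have "dist_null \<subseteq> {p. \<forall>g. Poly_Mapping.lookup p (pw_to_dist_gen g) = 0}"
  proof (rule dist_null_least)
    fix p :: "'k dist_gen \<Rightarrow>\<^sub>0 'f"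
    assume p: "p \<in> {p. \<forall>g. Poly_Mapping.lookup p (pw_to_dist_gen g) = 0}"
    have "Poly_Mapping.lookup (free_der p) (pw_to_dist_gen g) = 0" for g
      using p[simplified, THEN spec, of g]
      by (cases g) (simp_all add: lookup_free_der_One lookup_free_der_Step_zero der_zero)
    then show "free_der p \<in> {p. \<forall>g. Poly_Mapping.lookup p (pw_to_dist_gen g) = 0}"
      by simp
  next
    have "pw_to_dist_gen g \<noteq> Step a (Suc 0)" for g and a :: 'k
      by (cases g) simp_all
    then show "Poly_Mapping.single (Step a 1) (f - eval_at a f)
        \<in> {p. \<forall>g. Poly_Mapping.lookup p (pw_to_dist_gen g) = 0}" for a f
      by (simp add: lookup_single when_def) metis
  qed (simp_all add: lookup_add)
  with assms show ?thesis
    by auto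
qed

lemma free_E_dist_null:
  assumes "p \<in> dist_null"
  shows "free_E p = 0"
proof -
  have "free_E (Poly_Mapping.single g (Poly_Mapping.lookup p g)) = 0" for g
  proof (cases g)
    case One
    then show ?thesis
      using lookup_dist_null[OF assms, of POne]
      by (simp add: additive.zero[OF additive_free_E])
  next
    case (Step a k)
    then show ?thesis
      using lookup_dist_null[OF assms, of "PStep a"]
      by (cases k) (simp_all add: free_E_Step_Suc additive.zero[OF additive_free_E])
  qed
  then have "free_E (\<Sum>g\<in>Poly_Mapping.keys p. Poly_Mapping.single g (Poly_Mapping.lookup p g)) = 0"
    by (simp add: additive.sum[OF additive_free_E])
  then show ?thesis
    by (simp add: sum_single_lookup)
qed

text \<open>Integration by parts on the free module: apply \<open>I D = 1 - E\<close> to \<open>f p\<close>.\<close>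

lemma free_int_scale_free_der:
  "free_int (free_scale f (free_der p)) =
     free_scale f p - free_scale (eval0 f) (free_E p) - free_int (free_scale (der f) p)"
proof -
  have "free_int (free_der (free_scale f p)) = free_scale f p - free_scale (eval0 f) (free_E p)"
    using free_E_scale[of f p] by (simp add: free_E_def algebra_simps)
  then show ?thesis
    by (simp add: free_der_scale free_int_add algebra_simps)
qed

text \<open>The integral is not \<open>\<F>\<close>-linear, so an induction over the relations must treat all multiples
  \<open>f p\<close> of a relation \<open>p\<close> at once. For a derived relation, integration by parts reduces \<open>I (f Dp)\<close>
  to \<open>f p\<close> and \<open>I (f' p)\<close>, as \<open>E p = 0\<close>; for a generating one, \<open>I (f p)\<close> is already \<open>0\<close> in the free
  module since \<open>e\<^sub>a\<close> is multiplicative.\<close>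

lemma dist_null_free_int:
  assumes "p \<in> dist_null"
  shows "free_int p \<in> dist_null"
proof -
  have "dist_null \<subseteq> {p \<in> dist_null. \<forall>f. free_int (free_scale f p) \<in> dist_null}"
  proof (rule dist_null_least)
    show "p + q \<in> {p \<in> dist_null. \<forall>f. free_int (free_scale f p) \<in> dist_null}"
      if "p \<in> {p \<in> dist_null. \<forall>f. free_int (free_scale f p) \<in> dist_null}"
        "q \<in> {p \<in> dist_null. \<forall>f. free_int (free_scale f p) \<in> dist_null}" for p q
      using that by (simp add: dist_null_add free_scale_add free_int_add)
    show "free_scale f p \<in> {p \<in> dist_null. \<forall>f. free_int (free_scale f p) \<in> dist_null}"
      if "p \<in> {p \<in> dist_null. \<forall>f. free_int (free_scale f p) \<in> dist_null}" for f p
      using that by (simp add: dist_null_scale free_scale_mult[symmetric])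
    show "free_der p \<in> {p \<in> dist_null. \<forall>f. free_int (free_scale f p) \<in> dist_null}"
      if "p \<in> {p \<in> dist_null. \<forall>f. free_int (free_scale f p) \<in> dist_null}" for p
    proof -
      have p: "p \<in> dist_null" "\<And>f. free_int (free_scale f p) \<in> dist_null"
        using that by auto
      have "free_scale f p + - free_int (free_scale (der f) p) \<in> dist_null" for f
        by (intro dist_null_add dist_null_uminus dist_null_scale p)
      then show ?thesis
        by (simp add: p dist_null_free_der free_int_scale_free_der free_E_dist_null)
    qed
    show "Poly_Mapping.single (Step a 1) (f - eval_at a f)
        \<in> {p \<in> dist_null. \<forall>f. free_int (free_scale f p) \<in> dist_null}" for a f
    proof -
      have "free_int (free_scale h (Poly_Mapping.single (Step a 1) (f - eval_at a f))) = 0" for h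
        by (simp add: free_int_delta_zero eval_at_mult eval_at_diff eval_at_const der_eval_at)
      then show ?thesis
        using dist_null_delta[of a f] by (simp add: dist_null_zero)
    qed
  qed (simp add: dist_null_zero free_int_zero)
  then have "free_int (free_scale 1 p) \<in> dist_null"
    using assms by blast
  then show ?thesis
    by simp
qed

lemma free_der_free_int_delta:
  "free_der (free_int_delta a k f) - Poly_Mapping.single (Step a (Suc k)) f \<in> dist_null"
proof (induction k arbitrary: f)
  case 0
  have "free_der (free_int_delta a 0 f) - Poly_Mapping.single (Step a (Suc 0)) f =
      - Poly_Mapping.single (Step a 1) (f - eval_at a f)"
    by (simp add: free_int_delta_zero free_der_scale der_eval_at free_der_jump single_diff)
  then show ?case
    using dist_null_delta dist_null_uminus by metis
next
  case (Suc k)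
  have "free_der (free_int_delta a (Suc k) f) - Poly_Mapping.single (Step a (Suc (Suc k))) f =
      - (free_der (free_int_delta a k (der f)) - Poly_Mapping.single (Step a (Suc k)) (der f))"
    by (simp add: free_der_diff algebra_simps)
  then show ?case
    using Suc dist_null_uminus by metis
qed

lemma free_der_free_int: "free_der (free_int p) - p \<in> dist_null"
proof (induction p rule: poly_mapping_induct_add)
  case (single g f)
  show ?case
  proof (cases g)
    case One
    then show ?thesis by (simp add: der_intg dist_null_zero)
  next
    case (Step a k)
    show ?thesis
    proof (cases k)
      case 0
      then show ?thesis
        using Step dist_null_delta[of a "intg f"]
        by (simp add: free_der_diff free_der_scale der_intg der_eval_at free_der_jump single_diff)
    next
      case (Suc l)
      then show ?thesis
        using Step free_der_free_int_delta by simp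
    qed
  qed
next
  case (add p q)
  have "free_der (free_int (p + q)) - (p + q) =
      (free_der (free_int p) - p) + (free_der (free_int q) - q)"
    by (simp add: free_int_add free_der_add)
  then show ?case
    using dist_null_add[OF add] by (simp only:)
qed

text \<open>The left factor \<open>\<integral>f\<close> evaluates to \<open>0\<close>, hence so does \<open>(\<integral>f) \<cdot> I p\<close>, which is therefore the
  integral of its derivative. Only the replacement of \<open>D I p\<close> by \<open>p\<close> uses the relations.\<close>

lemma free_rota_baxter:
  "free_scale (intg f) (free_int p) -
     (free_int (free_scale f (free_int p)) + free_int (free_scale (intg f) p)) \<in> dist_null"
proof -
  have "free_scale (intg f) (free_int p) = free_int (free_der (free_scale (intg f) (free_int p)))"
    using free_E_scale[of "intg f" "free_int p"] by (simp add: free_E_def eval0_intg)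
  then have "free_scale (intg f) (free_int p) -
      (free_int (free_scale f (free_int p)) + free_int (free_scale (intg f) p)) =
      free_int (free_scale (intg f) (free_der (free_int p) - p))"
    by (simp add: free_der_scale der_intg free_int_add free_scale_diff free_int_diff)
  also have "\<dots> \<in> dist_null"
    by (intro dist_null_free_int dist_null_scale free_der_free_int)
  finally show ?thesis .
qed

section \<open>The distribution module is a Dirac module\<close>

lemma carrier_dist_module: "carrier dist_module = range dist.proj"
  and dist_add [simp]: "dist.proj p \<oplus>\<^bsub>dist_module\<^esub> dist.proj q = dist.proj (p + q)"
  and dist_minus [simp]: "dist.proj p \<ominus>\<^bsub>dist_module\<^esub> dist.proj q = dist.proj (p - q)"
  and dist_smult [simp]: "f \<odot>\<^bsub>dist_module\<^esub> dist.proj p = dist.proj (free_scale f p)"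
  using dist.carrier_quotient dist.proj_add[of p q] dist.proj_minus[of p q] dist.smult_proj[of f p]
  by (simp_all add: dist_module_def)

lemma dist_proj_closed [simp]: "dist.proj p \<in> carrier dist_module"
  by (simp add: carrier_dist_module)

lemma dist_proj_eqI: "p - q \<in> dist_null \<Longrightarrow> dist.proj p = dist.proj q"
  using dist.proj_eq_iff[of p q] by simp

lemma dist_der_proj [simp]: "dist_der (dist.proj p) = dist.proj (free_der p)"
  unfolding dist_der_def
  by (rule dist.induced_map_proj) (simp_all add: free_der_add dist_null_free_der)

lemma dist_int_proj [simp]: "dist_int (dist.proj p) = dist.proj (free_int p)"
  unfolding dist_int_def
  by (rule dist.induced_map_proj) (simp_all add: free_int_add dist_null_free_int)

lemma dist_carrierE:
  assumes "\<phi> \<in> carrier dist_module"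
  obtains p where "\<phi> = dist.proj p"
  using assms by (auto simp: carrier_dist_module)

lemma rota_baxter_dist: "rota_baxter_module scaleK intg dist_module dist_int"
proof (rule rota_baxter_module.intro)
  show "module ring_of_type_algebra dist_module"
    unfolding dist_module_def by (rule dist.module_quotient)
  show "rota_baxter_module_axioms scaleK intg dist_module dist_int"
  proof
    fix \<phi> \<psi> assume "\<phi> \<in> carrier dist_module" "\<psi> \<in> carrier dist_module"
    then obtain p q where [simp]: "\<phi> = dist.proj p" "\<psi> = dist.proj q"
      by (metis dist_carrierE)
    show "dist_int \<phi> \<in> carrier dist_module"
      by simp
    show "dist_int (\<phi> \<oplus>\<^bsub>dist_module\<^esub> \<psi>) = dist_int \<phi> \<oplus>\<^bsub>dist_module\<^esub> dist_int \<psi>"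
      by (simp add: free_int_add)
    show "dist_int (scaleK c 1 \<odot>\<^bsub>dist_module\<^esub> \<phi>) = scaleK c 1 \<odot>\<^bsub>dist_module\<^esub> dist_int \<phi>" for c
      by (simp add: free_int_mult_const der_scaleK_one)
    show "intg f \<odot>\<^bsub>dist_module\<^esub> dist_int \<phi> = dist_int (f \<odot>\<^bsub>dist_module\<^esub> dist_int \<phi>)
        \<oplus>\<^bsub>dist_module\<^esub> dist_int (intg f \<odot>\<^bsub>dist_module\<^esub> \<phi>)" for f
      by (simp add: dist_proj_eqI free_rota_baxter)
  qed
qed

lemma integro_differential_dist: "integro_differential_module scaleK der intg dist_module dist_der dist_int"
proof -
  have "differential_rota_baxter_module_axioms scaleK der dist_module dist_der dist_int"
  proof
    fix \<phi> \<psi> assume "\<phi> \<in> carrier dist_module" "\<psi> \<in> carrier dist_module"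
    then obtain p q where [simp]: "\<phi> = dist.proj p" "\<psi> = dist.proj q"
      by (metis dist_carrierE)
    show "dist_der \<phi> \<in> carrier dist_module"
      by simp
    show "dist_der (\<phi> \<oplus>\<^bsub>dist_module\<^esub> \<psi>) = dist_der \<phi> \<oplus>\<^bsub>dist_module\<^esub> dist_der \<psi>"
      by (simp add: free_der_add)
    show "dist_der (scaleK c 1 \<odot>\<^bsub>dist_module\<^esub> \<phi>) = scaleK c 1 \<odot>\<^bsub>dist_module\<^esub> dist_der \<phi>" for c
      by (simp add: free_der_scale der_scaleK_one)
    show "dist_der (f \<odot>\<^bsub>dist_module\<^esub> \<phi>) =
        der f \<odot>\<^bsub>dist_module\<^esub> \<phi> \<oplus>\<^bsub>dist_module\<^esub> f \<odot>\<^bsub>dist_module\<^esub> dist_der \<phi>" for f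
      by (simp add: free_der_scale)
    show "dist_der (dist_int \<phi>) = \<phi>"
      by (simp add: dist_proj_eqI free_der_free_int)
  qed
  then interpret M: differential_rota_baxter_module scaleK der intg dist_module dist_der dist_int
    by (intro differential_rota_baxter_module.intro rota_baxter_dist)
  show ?thesis
  proof
    show "M.E (f \<odot>\<^bsub>dist_module\<^esub> \<phi>) = eval0 f \<odot>\<^bsub>dist_module\<^esub> M.E \<phi>"
      if "\<phi> \<in> carrier dist_module" for \<phi> f
    proof -
      obtain p where [simp]: "\<phi> = dist.proj p"
        using \<open>\<phi> \<in> carrier dist_module\<close> by (rule dist_carrierE)
      have "M.E (dist.proj p) = dist.proj (free_E p)" for p
        by (simp add: M.E_def free_E_def)
      then show ?thesis
        by (simp add: free_E_scale)
    qed
  qed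
qed

lemma inj_dist_embed: "inj dist_embed"
proof (rule injI)
  fix p q :: "'k pw_gen \<Rightarrow>\<^sub>0 'f"
  assume "dist_embed p = dist_embed q"
  then have "pw_to_dist p - pw_to_dist q \<in> dist_null"
    using dist.proj_eq_iff by (simp add: dist_embed_def)
  then have "Poly_Mapping.lookup (pw_to_dist p - pw_to_dist q) (pw_to_dist_gen g) = 0" for g
    by (rule lookup_dist_null)
  then show "p = q"
    by (intro poly_mapping_eqI) (simp add: lookup_minus lookup_pw_to_dist)
qed

lemma linear_dist_embed: "linear_on_modules pw_module dist_module dist_embed"
  by (simp add: linear_on_modules_def dist_embed_def pw_to_dist_add pw_to_dist_scale)

lemma dist_embed_pw_int: "dist_embed (pw_int p) = dist_int (dist_embed p)"
  by (simp add: dist_embed_def free_int_pw_to_dist)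

text \<open>The embedding into the distribution module is injective and compatible with all operations, so
  the identities can be checked there.\<close>

lemma rota_baxter_pw: "rota_baxter_module scaleK intg pw_module pw_int"
proof (intro rota_baxter_module.intro module_free_module)
  interpret M: rota_baxter_module scaleK intg dist_module dist_int
    by (rule rota_baxter_dist)
  have closed: "dist_embed p \<in> carrier dist_module" for p
    by (simp add: dist_embed_def)
  have embed: "dist_embed (p + q) = dist_embed p \<oplus>\<^bsub>dist_module\<^esub> dist_embed q"
    "dist_embed (free_scale f p) = f \<odot>\<^bsub>dist_module\<^esub> dist_embed p" for p q f
    using linear_dist_embed by (simp_all add: linear_on_modules_def)
  show "rota_baxter_module_axioms scaleK intg pw_module pw_int"
  proof
    show "pw_int (p \<oplus>\<^bsub>pw_module\<^esub> q) = pw_int p \<oplus>\<^bsub>pw_module\<^esub> pw_int q" for p q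
      by (simp add: additive.add[OF additive_pw_int])
    show "pw_int (scaleK c 1 \<odot>\<^bsub>pw_module\<^esub> p) = scaleK c 1 \<odot>\<^bsub>pw_module\<^esub> pw_int p" for c p
      by (rule injD[OF inj_dist_embed]) (simp add: embed dist_embed_pw_int M.I_scale closed)
    show "intg f \<odot>\<^bsub>pw_module\<^esub> pw_int p =
        pw_int (f \<odot>\<^bsub>pw_module\<^esub> pw_int p) \<oplus>\<^bsub>pw_module\<^esub> pw_int (intg f \<odot>\<^bsub>pw_module\<^esub> p)" for f p
      by (rule injD[OF inj_dist_embed]) (simp add: embed dist_embed_pw_int M.rota_baxter closed)
  qed simp
qed

lemma dist_der_funpow_delta:
  "(dist_der ^^ k) (dist.proj (Poly_Mapping.single (Step a l) 1)) =
     dist.proj (Poly_Mapping.single (Step a (l + k)) 1)"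
  by (induction k) (simp_all add: der_one)

theorem dirac_dist: "dirac_module scaleK der intg S dist_module dist_der dist_int dist_embed"
proof -
  have delta: "(dist_der ^^ k) (dist_der (dist_embed (Poly_Mapping.single (PStep a) 1))) =
      dist.proj (Poly_Mapping.single (Step a (Suc k)) 1)" for a k
    using dist_der_funpow_delta[where l = 1] by (simp add: dist_embed_def der_one)
  show ?thesis
  proof (intro dirac_module.intro integro_differential_dist rota_baxter_hom.intro rota_baxter_pw
      rota_baxter_dist rota_baxter_hom_axioms.intro linear_dist_embed
      dirac_module_axioms.intro inj_dist_embed)
    show "ordinary_shifted_integro_differential_algebra scaleK der intg S"
      by (rule ordinary_shifted_integro_differential_algebra_axioms)
    show "commutes_on pw_module pw_int dist_int dist_embed"
      by (simp add: commutes_on_def dist_embed_pw_int)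
    fix a f k
    show "f \<odot>\<^bsub>dist_module\<^esub> (dist_der ^^ 0) (dist_der (dist_embed (Poly_Mapping.single (PStep a) 1))) =
        eval_at a f \<odot>\<^bsub>dist_module\<^esub> (dist_der ^^ 0) (dist_der (dist_embed (Poly_Mapping.single (PStep a) 1)))"
      unfolding delta using dist_null_delta[of a f]
      by (simp add: dist_proj_eqI single_diff)
    show "dist_int ((dist_der ^^ 0) (dist_der (dist_embed (Poly_Mapping.single (PStep a) 1)))) =
        dist_embed (Poly_Mapping.single (PStep a) 1) \<ominus>\<^bsub>dist_module\<^esub>
        coheaviside_scalar a \<odot>\<^bsub>dist_module\<^esub> dist_embed (Poly_Mapping.single POne 1)"
      unfolding delta by (simp add: free_int_delta_zero eval_at_one jump_def dist_embed_def)
    show "dist_int ((dist_der ^^ Suc k) (dist_der (dist_embed (Poly_Mapping.single (PStep a) 1)))) =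
        (dist_der ^^ k) (dist_der (dist_embed (Poly_Mapping.single (PStep a) 1)))"
      unfolding delta by (simp add: der_one additive.zero[OF additive_free_int_delta])
  qed
qed

end

section \<open>The universal property\<close>

lemma (in abelian_group) eq_of_minus_eq_zero:
  assumes "x \<ominus> y = \<zero>" "x \<in> carrier G" "y \<in> carrier G"
  shows "x = y"
proof -
  have "x = (x \<ominus> y) \<oplus> y"
    using assms(2,3) by (simp add: a_minus_def a_assoc l_neg)
  then show ?thesis
    using assms by simp
qed

context differential_rota_baxter_module
begin

lemma D_zero: "D \<zero>\<^bsub>M\<^esub> = \<zero>\<^bsub>M\<^esub>"
  using D_add[of "\<zero>\<^bsub>M\<^esub>" "\<zero>\<^bsub>M\<^esub>"] D_closed[of "\<zero>\<^bsub>M\<^esub>"] by simp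

lemma D_diff:
  assumes "\<phi> \<in> carrier M" "\<psi> \<in> carrier M"
  shows "D (\<phi> \<ominus>\<^bsub>M\<^esub> \<psi>) = D \<phi> \<ominus>\<^bsub>M\<^esub> D \<psi>"
proof -
  have "\<phi> = (\<phi> \<ominus>\<^bsub>M\<^esub> \<psi>) \<oplus>\<^bsub>M\<^esub> \<psi>"
    using assms by (simp add: a_minus_def M.a_assoc M.l_neg)
  then have "D \<phi> = D (\<phi> \<ominus>\<^bsub>M\<^esub> \<psi>) \<oplus>\<^bsub>M\<^esub> D \<psi>"
    using assms D_add by (metis M.minus_closed)
  then show ?thesis
    using assms by (simp add: a_minus_def M.a_assoc M.r_neg D_closed)
qed

end

context dirac_module
begin

text \<open>The only possible images of the generators under a morphism extending \<open>\<kappa>\<close>.\<close>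

primrec gen_image :: "'k dist_gen \<Rightarrow> 'm" where
  "gen_image One = \<kappa> (Poly_Mapping.single POne 1)"
| "gen_image (Step a k) = (D ^^ k) (step a)"

lemma \<kappa>_closed: "\<kappa> p \<in> carrier M"
  using emb.linear by (auto simp: linear_on_modules_def)

lemma gen_image_closed: "gen_image g \<in> carrier M"
proof (cases g)
  case (Step a k)
  have "(D ^^ k) (step a) \<in> carrier M"
    by (induction k) (simp_all add: step_def \<kappa>_closed D_closed)
  with Step show ?thesis
    by simp
qed (simp add: \<kappa>_closed)

sublocale lift: module_basis_map M gen_image
  by unfold_locales (rule gen_image_closed)

abbreviation lift where
  "lift \<equiv> module_extend M gen_image"

lemma delta_eq_gen_image: "delta a k = gen_image (Step a (Suc k))"
  by (simp add: delta_def funpow_swap1)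

lemma delta_closed: "delta a k \<in> carrier M"
  by (simp add: delta_eq_gen_image gen_image_closed del: gen_image.simps)

lemma D_delta: "D (delta a k) = delta a (Suc k)"
  by (simp add: delta_def)

text \<open>The embedding is assumed compatible with integrals but not with derivations. Because the
  coheaviside function is \<open>1\<close> at \<open>0\<close>, the equation \<open>I \<delta>\<^sub>0 = H\<^sub>0 - \<kappa>(1)\<close> holds; its derivative is
  \<open>\<delta>\<^sub>0 = \<delta>\<^sub>0 - D \<kappa>(1)\<close>.\<close>

lemma D_\<kappa>_one: "D (\<kappa> (Poly_Mapping.single POne 1)) = \<zero>\<^bsub>M\<^esub>"
proof -
  let ?u = "\<kappa> (Poly_Mapping.single POne 1)"
  have "costep 0 = ?u"
    by (simp add: costep_def coheaviside_def heaviside_def A.K.scale_one smult_one[simplified] \<kappa>_closed)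
  then have "I (delta 0 0) = step 0 \<ominus>\<^bsub>M\<^esub> ?u"
    using I_delta_0[of 0] by simp
  then have "delta 0 0 = delta 0 0 \<ominus>\<^bsub>M\<^esub> D ?u"
    using D_I[OF delta_closed[of 0 0]] by (simp add: D_diff step_def \<kappa>_closed delta_def)
  then have "delta 0 0 \<oplus>\<^bsub>M\<^esub> D ?u = delta 0 0"
    by (metis M.add.inv_solve_right' a_minus_def delta_closed D_closed \<kappa>_closed)
  then show ?thesis
    using M.add.l_cancel_one delta_closed D_closed \<kappa>_closed by metis
qed

lemma lift_free_der: "lift (A.free_der p) = D (lift p)"
proof (induction p rule: poly_mapping_induct_add)
  case (single g f)
  show ?case
    by (cases g) (simp_all add: lift.module_extend_add lift.module_extend_single D_smult
        gen_image_closed[of One, simplified] gen_image_closed[of "Step _ _", simplified] D_\<kappa>_one)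
next
  case (add p q)
  then show ?case
    by (simp add: A.free_der_add lift.module_extend_add D_add)
qed

text \<open>The kernel is closed under differentiation because the lift commutes with derivations; the
  generating relations hold in every Dirac module.\<close>

lemma lift_dist_null:
  assumes "p \<in> A.dist_null"
  shows "lift p = \<zero>\<^bsub>M\<^esub>"
proof -
  have "A.dist_null \<subseteq> {p. lift p = \<zero>\<^bsub>M\<^esub>}"
  proof (rule A.dist_null_least)
    have "(f - A.eval_at a f) \<odot>\<^bsub>M\<^esub> delta a 0 = \<zero>\<^bsub>M\<^esub>" for a f
    proof -
      let ?c = "A.eval_at a f"
      have "(f - ?c) \<odot>\<^bsub>M\<^esub> delta a 0 \<oplus>\<^bsub>M\<^esub> ?c \<odot>\<^bsub>M\<^esub> delta a 0 = ?c \<odot>\<^bsub>M\<^esub> delta a 0"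
        using smult_l_distr[of "f - ?c" ?c "delta a 0"] smult_delta[of f a] delta_closed by simp
      then show ?thesis
        using delta_closed by simp
    qed
    then show "Poly_Mapping.single (Step a 1) (f - A.eval_at a f) \<in> {p. lift p = \<zero>\<^bsub>M\<^esub>}" for a f
      by (simp add: lift.module_extend_single delta_def)
  qed (simp_all add: lift.module_extend_add lift.module_extend_scale lift_free_der D_zero
      lift.module_extend_zero smult_r_null[simplified])
  with assms show ?thesis
    by auto
qed

lemma lift_pw_to_dist: "lift (pw_to_dist p) = \<kappa> p"
proof (rule linear_on_free_module_eqI[of M "\<lambda>p. lift (pw_to_dist p)" \<kappa> p])
  show "linear_on_modules free_module M (\<lambda>p. lift (pw_to_dist p))"
    by (simp add: linear_on_modules_def pw_to_dist_add pw_to_dist_scale lift.module_extend_add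
        lift.module_extend_scale)
  show "lift (pw_to_dist (Poly_Mapping.single g 1)) = \<kappa> (Poly_Mapping.single g 1)" for g
    by (cases g) (simp_all add: lift.module_extend_single step_def \<kappa>_closed smult_one[simplified])
qed (rule emb.linear)

text \<open>The evaluation of \<open>\<delta>\<^sub>a\<^sup>(\<^sup>k\<^sup>)\<close> is \<open>\<delta>\<^sub>a\<^sup>(\<^sup>k\<^sup>) - I \<delta>\<^sub>a\<^sup>(\<^sup>k\<^sup>+\<^sup>1\<^sup>) = 0\<close>. So \<open>f \<delta>\<^sub>a\<^sup>(\<^sup>k\<^sup>)\<close>, too, evaluates to \<open>0\<close>
  and is the integral of its derivative.\<close>

lemma I_smult_delta_Suc:
  "I (f \<odot>\<^bsub>M\<^esub> delta a (Suc k)) = f \<odot>\<^bsub>M\<^esub> delta a k \<ominus>\<^bsub>M\<^esub> I (der f \<odot>\<^bsub>M\<^esub> delta a k)"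
proof -
  note closed = delta_closed[of a k] delta_closed[of a "Suc k"]
  have "E (f \<odot>\<^bsub>M\<^esub> delta a k) = \<zero>\<^bsub>M\<^esub>"
    using closed E_smult[OF closed(1), of f]
    by (simp add: E_def[of "delta a k"] D_delta I_delta_Suc a_minus_def M.r_neg smult_r_null[simplified])
  then have "f \<odot>\<^bsub>M\<^esub> delta a k = I (D (f \<odot>\<^bsub>M\<^esub> delta a k))"
    using closed by (simp add: E_def eq_of_minus_eq_zero I_closed D_closed)
  also have "\<dots> = I (der f \<odot>\<^bsub>M\<^esub> delta a k) \<oplus>\<^bsub>M\<^esub> I (f \<odot>\<^bsub>M\<^esub> delta a (Suc k))"
    using closed by (simp add: D_smult D_delta I_add)
  finally show ?thesis
    using closed by (simp add: a_minus_def M.a_ac M.r_neg1 M.r_neg2 M.r_neg I_closed)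
qed

text \<open>For \<open>k = 0\<close>, the factor \<open>f\<close> can be replaced by \<open>e\<^sub>a(f)\<close>, which lies in \<open>K\<close> and can be pulled out
  of the integral.\<close>

lemma lift_free_int_delta: "lift (A.free_int_delta a k f) = I (f \<odot>\<^bsub>M\<^esub> delta a k)"
proof (induction k arbitrary: f)
  case 0
  obtain c where c: "A.eval_at a f = scaleK c 1"
    using A.constant_scaleK A.der_eval_at by blast
  have jump: "lift (A.jump a) = step a \<ominus>\<^bsub>M\<^esub> costep a"
    by (simp add: A.jump_def lift.module_extend_diff lift.module_extend_single step_def costep_def
        \<kappa>_closed smult_one[simplified])
  have "I (f \<odot>\<^bsub>M\<^esub> delta a 0) = A.eval_at a f \<odot>\<^bsub>M\<^esub> I (delta a 0)"
    by (simp add: smult_delta[of f] c I_scale delta_closed)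
  then show ?case
    by (simp add: A.free_int_delta_zero lift.module_extend_scale I_delta_0 jump)
next
  case (Suc k)
  then show ?case
    by (simp add: lift.module_extend_diff lift.module_extend_single I_smult_delta_Suc
        del: gen_image.simps flip: delta_eq_gen_image)
qed

text \<open>The generators \<open>1\<close> and \<open>H\<^sub>a\<close> come from the piecewise extension, where \<open>\<kappa>\<close> preserves integrals.\<close>

lemma lift_free_int: "lift (A.free_int p) = I (lift p)"
proof (induction p rule: poly_mapping_induct_add)
  case (single g f)
  have pw: "lift (A.free_int (pw_to_dist q)) = I (lift (pw_to_dist q))" for q
    using emb.commutes by (simp add: A.free_int_pw_to_dist lift_pw_to_dist commutes_on_def)
  show ?case
  proof (cases g)
    case One
    then show ?thesis
      using pw[of "Poly_Mapping.single POne f"] by simp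
  next
    case (Step a k)
    show ?thesis
    proof (cases k)
      case 0
      then show ?thesis
        using Step pw[of "Poly_Mapping.single (PStep a) f"] by simp
    next
      case (Suc l)
      then show ?thesis
        using Step by (simp add: lift_free_int_delta lift.module_extend_single delta_eq_gen_image)
    qed
  qed
next
  case (add p q)
  then show ?case
    by (simp add: A.free_int_add lift.module_extend_add I_add)
qed

lemma lift_unique:
  assumes hom: "integro_differential_hom scaleK der intg A.dist_module A.dist_der A.dist_int M D I \<Phi>"
    and embed: "\<Phi> \<circ> A.dist_embed = \<kappa>"
  shows "\<Phi> (A.dist.proj p) = lift p"
proof (rule linear_on_free_module_eqI[of M "\<lambda>p. \<Phi> (A.dist.proj p)" lift p])
  interpret \<Phi>: integro_differential_hom scaleK der intg A.dist_module A.dist_der A.dist_int M D I \<Phi>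
    by (rule hom)
  have linear: "\<Phi> (A.dist.proj p) \<in> carrier M"
    "\<Phi> (A.dist.proj (p + q)) = \<Phi> (A.dist.proj p) \<oplus>\<^bsub>M\<^esub> \<Phi> (A.dist.proj q)"
    "\<Phi> (A.dist.proj (free_scale f p)) = f \<odot>\<^bsub>M\<^esub> \<Phi> (A.dist.proj p)" for p q f
    using \<Phi>.linear A.dist_proj_closed by (auto simp: linear_on_modules_def simp flip: A.dist_add A.dist_smult)
  show "linear_on_modules free_module M (\<lambda>p. \<Phi> (A.dist.proj p))"
    by (simp add: linear_on_modules_def linear)
  have der: "\<Phi> (A.dist.proj (A.free_der p)) = D (\<Phi> (A.dist.proj p))" for p
    using \<Phi>.commutes_D A.dist_proj_closed A.dist_der_proj by (metis commutes_on_def)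
  have pw: "\<Phi> (A.dist.proj (pw_to_dist q)) = \<kappa> q" for q
    using fun_cong[OF embed, of q] by (simp add: A.dist_embed_def)
  show "\<Phi> (A.dist.proj (Poly_Mapping.single g 1)) = lift (Poly_Mapping.single g 1)" for g
  proof (cases g)
    case One
    then show ?thesis
      using pw[of "Poly_Mapping.single POne 1"]
      by (simp add: lift.module_extend_single \<kappa>_closed smult_one[simplified])
  next
    case (Step a k)
    have "\<Phi> (A.dist.proj (Poly_Mapping.single (Step a k) 1)) = (D ^^ k) (step a)"
    proof (induction k)
      case 0
      show ?case
        using pw[of "Poly_Mapping.single (PStep a) 1"] by (simp add: step_def)
    next
      case (Suc k)
      then show ?case
        using der[of "Poly_Mapping.single (Step a k) 1"] by (simp add: A.der_one)
    qed
    then show ?thesis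
      using Step gen_image_closed[of g] by (simp add: lift.module_extend_single smult_one[simplified])
  qed
qed (rule lift.linear_module_extend)

theorem ex1_integro_differential_hom:
  "\<exists>!\<Phi>. \<Phi> \<in> extensional (carrier A.dist_module) \<and>
     integro_differential_hom scaleK der intg A.dist_module A.dist_der A.dist_int M D I \<Phi> \<and>
     \<Phi> \<circ> A.dist_embed = \<kappa>"
proof (rule ex1I)
  let ?\<Phi> = "quotient_lift dist_free A.dist_null lift"
  have proj: "?\<Phi> (A.dist.proj p) = lift p" for p
    by (rule A.dist.quotient_lift_proj) (simp_all add: lift.module_extend_add lift_dist_null)
  have "linear_on_modules A.dist_module M ?\<Phi>"
    by (auto simp: linear_on_modules_def A.carrier_dist_module proj lift.module_extend_add
        lift.module_extend_scale)
  moreover have "commutes_on A.dist_module A.dist_der D ?\<Phi>" "commutes_on A.dist_module A.dist_int I ?\<Phi>"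
    by (auto simp: commutes_on_def A.carrier_dist_module proj lift_free_der lift_free_int)
  ultimately have "integro_differential_hom scaleK der intg A.dist_module A.dist_der A.dist_int M D I ?\<Phi>"
    by (intro integro_differential_hom.intro integro_differential_hom_axioms.intro
        A.integro_differential_dist integro_differential_module_axioms)
  moreover have "?\<Phi> \<in> extensional (carrier A.dist_module)"
    by (simp add: quotient_lift_def A.dist_module_def)
  moreover have "?\<Phi> \<circ> A.dist_embed = \<kappa>"
    by (rule ext) (simp add: A.dist_embed_def proj lift_pw_to_dist)
  ultimately show "?\<Phi> \<in> extensional (carrier A.dist_module) \<and>
      integro_differential_hom scaleK der intg A.dist_module A.dist_der A.dist_int M D I ?\<Phi> \<and>
      ?\<Phi> \<circ> A.dist_embed = \<kappa>"
    by simp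
  fix \<Psi>
  assume \<Psi>: "\<Psi> \<in> extensional (carrier A.dist_module) \<and>
     integro_differential_hom scaleK der intg A.dist_module A.dist_der A.dist_int M D I \<Psi> \<and>
     \<Psi> \<circ> A.dist_embed = \<kappa>"
  show "\<Psi> = ?\<Phi>"
  proof (rule extensionalityI)
    show "\<Psi> C = ?\<Phi> C" if C: "C \<in> carrier A.dist_module" for C
    proof -
      obtain p where "C = A.dist.proj p"
        using C by (rule A.dist_carrierE)
      then show ?thesis
        using \<Psi> lift_unique[of \<Psi> p] by (simp only: proj)
    qed
  qed (use \<Psi> \<open>?\<Phi> \<in> extensional _\<close> in auto)
qed

end

theorem proposition17:
  fixes scaleK :: "'k::linordered_field \<Rightarrow> 'f::comm_ring_1 \<Rightarrow> 'f"
    and der :: "'f \<Rightarrow> 'f" and intg :: "'f \<Rightarrow> 'f" and S :: "'k \<Rightarrow> 'f \<Rightarrow> 'f"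
  assumes "ordinary_shifted_integro_differential_algebra scaleK der intg S"
  defines "DF \<equiv> ordinary_shifted_integro_differential_algebra.dist_module der intg S"
    and "D \<equiv> ordinary_shifted_integro_differential_algebra.dist_der der intg S"
    and "I \<equiv> ordinary_shifted_integro_differential_algebra.dist_int scaleK der intg S"
    and "\<iota> \<equiv> ordinary_shifted_integro_differential_algebra.dist_embed der intg S"
  shows "dirac_module scaleK der intg S DF D I \<iota> \<and>
    (\<forall>(M :: ('f, 'm) module) D\<^sub>M I\<^sub>M \<kappa>. dirac_module scaleK der intg S M D\<^sub>M I\<^sub>M \<kappa> \<longrightarrow>
      (\<exists>!\<Phi>. \<Phi> \<in> extensional (carrier DF) \<and>
        integro_differential_hom scaleK der intg DF D I M D\<^sub>M I\<^sub>M \<Phi> \<and> \<Phi> \<circ> \<iota> = \<kappa>))"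
  unfolding DF_def D_def I_def \<iota>_def
  by (intro conjI allI impI ordinary_shifted_integro_differential_algebra.dirac_dist[OF assms(1)])
    (rule dirac_module.ex1_integro_differential_hom)

end
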